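(* Let $m, M$ be real numbers with $0<m\le M$, let $A,B\in\mathbb{B}(\mathscr{H})$ satisfy $mI\le A\le MI$ and $mI\le B\le MI$, let $\Phi:\mathbb{B}(\mathscr{H})\to\mathbb{B}(\mathscr{K})$ be a positive unital linear map, let $\nu\in[0,1]$ and let $p>0$. Put $r=\min\{\nu,1-\nu\}$ and $$\alpha=\max\left\{\frac{(M+m)^2}{4Mm},\ \frac{(M+m)^2}{4^{2/p}Mm}\right\}.$$ Then $$\Big(\Phi\big(A\nabla_\nu B+2rMm(A^{-1}\nabla B^{-1}-A^{-1}\sharp B^{-1})\big)\Big)^p\le\alpha^p\,\big(\Phi(A\sharp_\nu B)\big)^p$$ and $$\Big(\Phi\big(A\nabla_\nu B+2rMm(A^{-1}\nabla B^{-1}-A^{-1}\sharp B^{-1})\big)\Big)^p\le\alpha^p\,\big(\Phi(A)\sharp_\nu\Phi(B)\big)^p.$$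
   Context: $\mathscr{H},\mathscr{K}$ are complex Hilbert spaces, $\mathbb{B}(\mathscr{H})$ is the $C^*$-algebra of bounded linear operators on $\mathscr{H}$, and $I$ is the identity. For self-adjoint operators, $X\le Y$ means $\langle (Y-X)x,x\rangle\ge 0$ for all $x$ (so $Y-X$ is positive); $X>0$ means $X$ is positive and invertible. A linear map $\Phi$ is positive if $\Phi(X)\ge 0$ whenever $X\ge 0$, and unital if $\Phi(I)=I$. For $A,B>0$ and $\nu\in[0,1]$, the weighted arithmetic and geometric means are $A\nabla_\nu B=(1-\nu)A+\nu B$ and $A\sharp_\nu B=A^{1/2}\left(A^{-1/2}BA^{-1/2}\right)^{\nu}A^{1/2}$; $\nabla=\nabla_{1/2}$ and $\sharp=\sharp_{1/2}$. Real powers of positive invertible operators are taken by continuous functional calculus (the paper writes $\Phi^p(X)$ for $(\Phi(X))^p$). *)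

theory Defs
  imports "HOL-Analysis.Analysis" "HOL-Computational_Algebra.Polynomial"
begin

section \<open>Complex Hilbert spaces\<close>

class complex_vector = real_vector +
  fixes scaleC :: "complex \<Rightarrow> 'a \<Rightarrow> 'a"  (infixr "*\<^sub>C" 75)
  assumes scaleC_add_right: "c *\<^sub>C (x + y) = c *\<^sub>C x + c *\<^sub>C y"
    and scaleC_add_left: "(c + d) *\<^sub>C x = c *\<^sub>C x + d *\<^sub>C x"
    and scaleC_scaleC: "c *\<^sub>C (d *\<^sub>C x) = (c * d) *\<^sub>C x"
    and scaleC_one: "1 *\<^sub>C x = x"
    and scaleR_scaleC: "r *\<^sub>R x = complex_of_real r *\<^sub>C x"

abbreviation clinear :: "('a::complex_vector \<Rightarrow> 'b::complex_vector) \<Rightarrow> bool"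
  where "clinear \<equiv> Vector_Spaces.linear scaleC scaleC"

class complex_inner = complex_vector + real_normed_vector +
  fixes cinner :: "'a \<Rightarrow> 'a \<Rightarrow> complex"
  assumes cinner_commute: "cinner x y = cnj (cinner y x)"
    and cinner_add_left: "cinner (x + y) z = cinner x z + cinner y z"
    and cinner_scaleC_left: "cinner (c *\<^sub>C x) y = c * cinner x y"
    and cinner_ge_zero: "0 \<le> Re (cinner x x)"
    and cinner_eq_zero_iff: "cinner x x = 0 \<longleftrightarrow> x = 0"
    and norm_eq_sqrt_cinner: "norm x = sqrt (Re (cinner x x))"

class chilbert = complex_inner + complete_space

lemma norm_scaleC: "norm (c *\<^sub>C x) = cmod c * norm (x::'a::complex_inner)"
proof -
  have "cinner x (c *\<^sub>C x) = cnj c * cinner x x"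
    by (metis cinner_commute cinner_scaleC_left complex_cnj_mult)
  then have "cinner (c *\<^sub>C x) (c *\<^sub>C x) = complex_of_real ((cmod c)\<^sup>2) * cinner x x"
    by (simp only: cinner_scaleC_left complex_norm_square mult.assoc)
  then have "Re (cinner (c *\<^sub>C x) (c *\<^sub>C x)) = (cmod c)\<^sup>2 * Re (cinner x x)"
    by simp
  then show ?thesis
    by (simp add: norm_eq_sqrt_cinner real_sqrt_mult)
qed

lemma scaleC_scaleR_commute:
  "c *\<^sub>C (r *\<^sub>R x) = r *\<^sub>R (c *\<^sub>C (x::'a::complex_vector))"
  by (simp add: scaleR_scaleC scaleC_scaleC mult.commute)

lemma bounded_linear_scaleC: "bounded_linear (\<lambda>x::'a::complex_inner. c *\<^sub>C x)"
proof (rule bounded_linear_intro)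
  show "c *\<^sub>C (x + y) = c *\<^sub>C x + c *\<^sub>C y" for x y :: 'a
    by (rule scaleC_add_right)
  show "c *\<^sub>C (r *\<^sub>R x) = r *\<^sub>R (c *\<^sub>C x)" for r and x :: 'a
    by (rule scaleC_scaleR_commute)
  show "norm (c *\<^sub>C x) \<le> norm x * cmod c" for x :: 'a
    by (simp add: norm_scaleC)
qed

lemmas scaleC_right_simps = linear_simps[OF bounded_linear_scaleC]

section \<open>The algebra of bounded operators\<close>

typedef (overloaded) 'a bop =
  "{T :: 'a::complex_inner \<Rightarrow>\<^sub>L 'a. \<forall>c x. blinfun_apply T (c *\<^sub>C x) = c *\<^sub>C blinfun_apply T x}"
  by (rule exI[of _ id_blinfun]) simp

setup_lifting type_definition_bop

lift_definition bop_apply :: "'a::complex_inner bop \<Rightarrow> 'a \<Rightarrow> 'a" is blinfun_apply .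

instantiation bop :: (complex_inner) real_normed_algebra
begin

lift_definition zero_bop :: "'a bop" is 0
  by (simp add: blinfun.zero_left scaleC_right_simps)

lift_definition plus_bop :: "'a bop \<Rightarrow> 'a bop \<Rightarrow> 'a bop" is "(+)"
  by (simp add: blinfun.add_left scaleC_add_right)

lift_definition uminus_bop :: "'a bop \<Rightarrow> 'a bop" is uminus
  by (simp add: blinfun.minus_left scaleC_right_simps)

lift_definition minus_bop :: "'a bop \<Rightarrow> 'a bop \<Rightarrow> 'a bop" is "(-)"
  by (simp add: blinfun.diff_left scaleC_right_simps)

lift_definition scaleR_bop :: "real \<Rightarrow> 'a bop \<Rightarrow> 'a bop" is scaleR
  by (simp add: blinfun.scaleR_left scaleC_scaleR_commute)

lift_definition times_bop :: "'a bop \<Rightarrow> 'a bop \<Rightarrow> 'a bop" is blinfun_compose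
  by simp

lift_definition norm_bop :: "'a bop \<Rightarrow> real" is norm .

definition dist_bop :: "'a bop \<Rightarrow> 'a bop \<Rightarrow> real"
  where "dist_bop X Y = norm (X - Y)"

definition sgn_bop :: "'a bop \<Rightarrow> 'a bop"
  where "sgn_bop X = inverse (norm X) *\<^sub>R X"

definition uniformity_bop :: "('a bop \<times> 'a bop) filter"
  where "uniformity_bop = (INF e\<in>{0<..}. principal {(X, Y). dist X Y < e})"

definition open_bop :: "'a bop set \<Rightarrow> bool"
  where "open_bop U \<longleftrightarrow>
    (\<forall>X\<in>U. eventually (\<lambda>(X', Y). X' = X \<longrightarrow> Y \<in> U) uniformity)"

instance
proof
  show "dist X Y = norm (X - Y)" for X Y :: "'a bop"
    by (rule dist_bop_def)
  show "sgn X = inverse (norm X) *\<^sub>R X" for X :: "'a bop"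
    by (rule sgn_bop_def)
  show "uniformity = (INF e\<in>{0<..}. principal {(X::'a bop, Y). dist X Y < e})"
    by (rule uniformity_bop_def)
  show "open U \<longleftrightarrow> (\<forall>X\<in>U. \<forall>\<^sub>F (X', Y) in uniformity. X' = X \<longrightarrow> Y \<in> U)"
    for U :: "'a bop set"
    by (rule open_bop_def)
  show "X + Y + Z = X + (Y + Z)" "X + Y = Y + X" "0 + X = X" "- X + X = 0" "X - Y = X + - Y"
    for X Y Z :: "'a bop"
    by (transfer; simp)+
  show "a *\<^sub>R (X + Y) = a *\<^sub>R X + a *\<^sub>R Y" "(a + b) *\<^sub>R X = a *\<^sub>R X + b *\<^sub>R X"
    "a *\<^sub>R b *\<^sub>R X = (a * b) *\<^sub>R X" "1 *\<^sub>R X = X"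
    for a b and X Y :: "'a bop"
    by (transfer; simp add: scaleR_add_right scaleR_add_left)+
  show "X * Y * Z = X * (Y * Z)" "(X + Y) * Z = X * Z + Y * Z" "X * (Y + Z) = X * Y + X * Z"
    "(a *\<^sub>R X) * Y = a *\<^sub>R (X * Y)" "X * (a *\<^sub>R Y) = a *\<^sub>R (X * Y)"
    for a and X Y Z :: "'a bop"
    by (transfer; rule blinfun_eqI; simp add: blinfun.bilinear_simps)+
  show "norm X = 0 \<longleftrightarrow> X = 0" "norm (X + Y) \<le> norm X + norm Y"
    "norm (a *\<^sub>R X) = \<bar>a\<bar> * norm X" "norm (X * Y) \<le> norm X * norm Y"
    for a and X Y :: "'a bop"
    by (transfer; simp add: norm_triangle_ineq norm_blinfun_compose)+
qed

end

instantiation bop :: (complex_inner) monoid_mult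
begin

lift_definition one_bop :: "'a bop" is id_blinfun
  by simp

instance
proof
  show "1 * X = X" "X * 1 = X" for X :: "'a bop"
    by (transfer; rule blinfun_eqI; simp)+
qed

end

lift_definition blinfun_scaleC :: "complex \<Rightarrow> ('a \<Rightarrow>\<^sub>L 'a) \<Rightarrow> ('a::complex_inner \<Rightarrow>\<^sub>L 'a)"
  is "\<lambda>c T x. c *\<^sub>C T x"
  by (rule bounded_linear_compose[OF bounded_linear_scaleC])

instantiation bop :: (complex_inner) complex_vector
begin

lift_definition scaleC_bop :: "complex \<Rightarrow> 'a bop \<Rightarrow> 'a bop" is blinfun_scaleC
  by (simp only: blinfun_scaleC.rep_eq scaleC_scaleC mult.commute simp_thms)

instance
proof
  fix c d :: complex and r :: real and X Y :: "'a bop"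
  show "c *\<^sub>C (X + Y) = c *\<^sub>C X + c *\<^sub>C Y"
    by (transfer, rule blinfun_eqI)
       (simp only: blinfun_scaleC.rep_eq blinfun.add_left scaleC_add_right)
  show "(c + d) *\<^sub>C X = c *\<^sub>C X + d *\<^sub>C X"
    by (transfer, rule blinfun_eqI)
       (simp only: blinfun_scaleC.rep_eq blinfun.add_left scaleC_add_left)
  show "c *\<^sub>C d *\<^sub>C X = (c * d) *\<^sub>C X"
    by (transfer, rule blinfun_eqI) (simp only: blinfun_scaleC.rep_eq scaleC_scaleC)
  show "1 *\<^sub>C X = X"
    by (transfer, rule blinfun_eqI) (simp only: blinfun_scaleC.rep_eq scaleC_one)
  show "r *\<^sub>R X = complex_of_real r *\<^sub>C X"
    by (transfer, rule blinfun_eqI)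
       (simp only: blinfun_scaleC.rep_eq blinfun.scaleR_left scaleR_scaleC)
qed

end

section \<open>Self-adjointness and the operator order\<close>

definition selfadjoint :: "'a::complex_inner bop \<Rightarrow> bool" where
  "selfadjoint X \<longleftrightarrow> (\<forall>x y. cinner (bop_apply X x) y = cinner x (bop_apply X y))"

definition positive_op :: "'a::complex_inner bop \<Rightarrow> bool" where
  "positive_op X \<longleftrightarrow> selfadjoint X \<and> (\<forall>x. 0 \<le> Re (cinner (bop_apply X x) x))"

lemma bop_apply_simps:
  "bop_apply 0 x = 0" "bop_apply (X + Y) x = bop_apply X x + bop_apply Y x"
  "bop_apply (- X) x = - bop_apply X x" "bop_apply (X - Y) x = bop_apply X x - bop_apply Y x"
  "bop_apply X (x + y) = bop_apply X x + bop_apply X y"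
  by (transfer; simp add: blinfun.bilinear_simps)+

lemma bop_eqI: "(\<And>x. bop_apply X x = bop_apply Y x) \<Longrightarrow> X = Y"
  by transfer (rule blinfun_eqI)

lemma cinner_add_right: "cinner x (y + z) = cinner x y + cinner x (z::'a::complex_inner)"
  by (metis cinner_add_left cinner_commute complex_cnj_add)

lemma cinner_zero: "cinner 0 x = 0" "cinner x (0::'a::complex_inner) = 0"
  by (metis add_cancel_right_right cinner_add_left) (metis add_cancel_right_right cinner_add_right)

lemma cinner_minus: "cinner (- x) y = - cinner x y" "cinner x (- y) = - cinner x (y::'a::complex_inner)"
  by (metis add.right_inverse cinner_add_left cinner_zero(1) minus_unique)
     (metis add.right_inverse cinner_add_right cinner_zero(2) minus_unique)

lemma positive_op_zero: "positive_op 0"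
  by (simp add: positive_op_def selfadjoint_def bop_apply_simps cinner_zero)

lemma positive_op_add:
  assumes "positive_op X" "positive_op Y"
  shows "positive_op (X + Y)"
  unfolding positive_op_def selfadjoint_def bop_apply_simps cinner_add_left cinner_add_right plus_complex.sel
proof (intro conjI allI)
  show "cinner (bop_apply X x) y + cinner (bop_apply Y x) y
      = cinner x (bop_apply X y) + cinner x (bop_apply Y y)" for x y
    using assms by (simp only: positive_op_def selfadjoint_def)
  show "0 \<le> Re (cinner (bop_apply X x) x) + Re (cinner (bop_apply Y x) x)" for x
    using assms by (intro add_nonneg_nonneg) (simp_all only: positive_op_def)
qed

lemma positive_op_antisym:
  assumes "positive_op X" "positive_op (- X)"
  shows "X = 0"
proof (rule bop_eqI)
  fix x
  have sa: "cinner (bop_apply X x) y = cinner x (bop_apply X y)" for x y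
    using assms(1) by (simp only: positive_op_def selfadjoint_def)
  have 0: "Re (cinner (bop_apply X x) x) = 0" for x
  proof (rule antisym)
    have "0 \<le> Re (cinner (bop_apply (- X) x) x)"
      using assms(2) by (simp only: positive_op_def)
    then show "Re (cinner (bop_apply X x) x) \<le> 0"
      by (simp only: bop_apply_simps cinner_minus uminus_complex.sel neg_0_le_iff_le)
    show "0 \<le> Re (cinner (bop_apply X x) x)"
      using assms(1) by (simp only: positive_op_def)
  qed
  define y where "y = bop_apply X x"
  have "Re (cinner (bop_apply X (x + y)) (x + y)) = Re (cinner (bop_apply X x) x)
      + Re (cinner y y) + Re (cinner (bop_apply X y) x) + Re (cinner (bop_apply X y) y)"
    by (simp only: bop_apply_simps cinner_add_left cinner_add_right plus_complex.sel y_def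
        add.assoc)
  moreover have "Re (cinner (bop_apply X y) x) = Re (cinner y y)"
    by (simp only: sa y_def)
  ultimately have "Re (cinner y y) = 0"
    using 0[of "x + y"] 0[of x] 0[of y] by linarith
  then have "norm y = 0"
    by (simp only: norm_eq_sqrt_cinner real_sqrt_zero)
  then show "bop_apply X x = bop_apply 0 x"
    by (simp only: bop_apply_simps norm_eq_zero y_def)
qed

(* The strict relation is the one induced by the partial order; it does not mean that the
   difference is positive and invertible. *)
instantiation bop :: (complex_inner) ordered_ab_group_add
begin

definition less_eq_bop :: "'a bop \<Rightarrow> 'a bop \<Rightarrow> bool"
  where "X \<le> Y \<longleftrightarrow> positive_op (Y - X)"

definition less_bop :: "'a bop \<Rightarrow> 'a bop \<Rightarrow> bool"
  where "(X::'a bop) < Y \<longleftrightarrow> X \<le> Y \<and> \<not> Y \<le> X"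

instance
proof
  fix X Y Z :: "'a bop"
  show "X < Y \<longleftrightarrow> X \<le> Y \<and> \<not> Y \<le> X"
    by (rule less_bop_def)
  show "X \<le> X"
    by (simp add: less_eq_bop_def positive_op_zero)
  show "X \<le> Z" if "X \<le> Y" "Y \<le> Z"
    using positive_op_add[of "Y - X" "Z - Y"] that by (simp add: less_eq_bop_def)
  show "X = Y" if "X \<le> Y" "Y \<le> X"
    using positive_op_antisym[of "Y - X"] that by (simp add: less_eq_bop_def)
  show "Z + X \<le> Z + Y" if "X \<le> Y"
    using that by (simp add: less_eq_bop_def)
qed

end

section \<open>Inverse, spectrum and continuous functional calculus\<close>

definition invertible_op :: "'a::complex_inner bop \<Rightarrow> bool" where
  "invertible_op X \<longleftrightarrow> (\<exists>Y. X * Y = 1 \<and> Y * X = 1)"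

definition inv_op :: "'a::complex_inner bop \<Rightarrow> 'a bop" where
  "inv_op X = (THE Y. X * Y = 1 \<and> Y * X = 1)"

definition spectrum_op :: "'a::complex_inner bop \<Rightarrow> complex set" where
  "spectrum_op X = {z. \<not> invertible_op (z *\<^sub>C 1 - X)}"

definition poly_op :: "real poly \<Rightarrow> 'a::complex_inner bop \<Rightarrow> 'a bop" where
  "poly_op q X = (\<Sum>i\<le>degree q. coeff q i *\<^sub>R X ^ i)"

(* f(X) for self-adjoint X (whose spectrum is real) and f real-valued and continuous on the
   spectrum: the norm limit of q_n(X) for polynomials q_n converging to f uniformly on the
   spectrum.  Such q_n exist by Weierstrass, and the limit does not depend on their choice. *)
definition cfc :: "(real \<Rightarrow> real) \<Rightarrow> 'a::complex_inner bop \<Rightarrow> 'a bop" where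
  "cfc f X = (THE Y. \<exists>q :: nat \<Rightarrow> real poly.
     uniform_limit {t. complex_of_real t \<in> spectrum_op X} (\<lambda>n. poly (q n)) f sequentially \<and>
     (\<lambda>n. poly_op (q n) X) \<longlonglongrightarrow> Y)"

(* Meant for positive invertible X, where t powr a is continuous on the spectrum. *)
definition powr_op :: "'a::complex_inner bop \<Rightarrow> real \<Rightarrow> 'a bop"  (infixr "powr\<^sub>o" 80) where
  "X powr\<^sub>o a = cfc (\<lambda>t. t powr a) X"

section \<open>Operator means and positive maps\<close>

definition arith_mean :: "real \<Rightarrow> 'a::complex_inner bop \<Rightarrow> 'a bop \<Rightarrow> 'a bop" where
  "arith_mean \<nu> A B = (1 - \<nu>) *\<^sub>R A + \<nu> *\<^sub>R B"

definition geom_mean :: "real \<Rightarrow> 'a::complex_inner bop \<Rightarrow> 'a bop \<Rightarrow> 'a bop" where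
  "geom_mean \<nu> A B =
     A powr\<^sub>o (1/2) * (A powr\<^sub>o (-1/2) * B * A powr\<^sub>o (-1/2)) powr\<^sub>o \<nu> * A powr\<^sub>o (1/2)"

definition positive_map :: "('a::complex_inner bop \<Rightarrow> 'b::complex_inner bop) \<Rightarrow> bool" where
  "positive_map \<Phi> \<longleftrightarrow> (\<forall>X. 0 \<le> X \<longrightarrow> 0 \<le> \<Phi> X)"

end

theory Submission
  imports Defs "HOL-Computational_Algebra.Fundamental_Theorem_Algebra"
begin

text \<open>
  Let \<open>G\<close> be the weighted geometric mean of \<open>A\<close> and \<open>B\<close>, and \<open>X\<close> the argument of \<open>\<Phi>\<close> on the left-hand
  sides.  The inverse of \<open>G\<close> is the weighted geometric mean of the inverses, and the refined Young inequality
  (\<open>refined_young_geom_mean\<close>) shows that adding to it the correction term \<open>2r\<close> times the gap between the means of the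
  inverses gives at most their weighted arithmetic mean.  Since \<open>A + Mm A\<^sup>-\<^sup>1 \<le> M + m\<close>, and likewise for \<open>B\<close>,
  it follows that \<open>X + Mm G\<^sup>-\<^sup>1 \<le> M + m\<close>.  Apply \<open>\<Phi>\<close>.  For every \<open>Q \<ge> \<Phi> G\<close> Choi's inequality and the antitonicity of
  the inverse (\<open>inv_op_le_of_unital_positive_le\<close>) give \<open>\<Phi> X + Mm Q\<^sup>-\<^sup>1 \<le> M + m\<close>.  One takes \<open>Q = \<Phi> G\<close> for the first
  claim and, by Ando's inequality (\<open>unital_positive_geom_mean_le\<close>), the geometric mean of \<open>\<Phi> A\<close> and \<open>\<Phi> B\<close> for the
  second.

  It remains to see why \<open>P + h Q\<^sup>-\<^sup>1 \<le> L\<close> bounds \<open>P\<^bsup>p\<^esup>\<close> by a multiple of \<open>Q\<^bsup>p\<^esup>\<close>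
  (\<open>powr_op_le_of_add_inv_op_le\<close>).  For \<open>p = 2\<close> this is the operator inequality \<open>\<parallel>E F\<parallel> \<le> \<parallel>E + F\<parallel>\<^sup>2 / 4\<close>.  For
  larger \<open>p\<close> it is applied to powers of the two summands, which after scaling are at most one and so decrease under
  powers with exponent at least one.  For smaller \<open>p\<close> the case \<open>p = 2\<close> is combined with the Loewner-Heinz inequality.

  The inequalities of Choi, Ando and Loewner-Heinz all come from one source: a positive map
  is 2-positive on the commutative algebra generated by a single operator (\<open>positive_map_block_nonneg\<close>).  Applied to
  powers, this yields a midpoint property in the exponent, and midpoints with continuity give all exponents in the unit
  interval (\<open>unital_positive_powr_le\<close>).

  The functional calculus underneath rests on the bound of \<open>\<parallel>q(T)\<parallel>\<close> by the supremum of \<open>\<bar>q\<bar>\<close> over the real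
  spectrum of a self-adjoint \<open>T\<close> (\<open>norm_poly_op_le\<close>), obtained by factoring real polynomials.
\<close>

section \<open>Real inner product and operator order\<close>

text \<open>
  The quadratic forms, the order and the norm see only the real part of the inner product, and
  the algebra of bounded operators is a real algebra; working with a real bilinear form avoids
  conjugations throughout.
\<close>

definition rinner :: "'a::complex_inner \<Rightarrow> 'a \<Rightarrow> real"
  where "rinner x y = Re (cinner x y)"

lemma rinner_commute: "rinner x y = rinner y x"
  unfolding rinner_def by (subst cinner_commute) simp

lemma rinner_self: "rinner x x = (norm x)\<^sup>2"
  by (simp add: rinner_def norm_eq_sqrt_cinner cinner_ge_zero)

lemma rinner_add_left: "rinner (x + y) z = rinner x z + rinner y z"
  by (simp add: rinner_def cinner_add_left)

lemma rinner_scaleR_left: "rinner (c *\<^sub>R x) y = c * rinner x y"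
  by (simp add: rinner_def scaleR_scaleC cinner_scaleC_left)

lemma rinner_add_right: "rinner x (y + z) = rinner x y + rinner x z"
  by (metis rinner_add_left rinner_commute)

lemma rinner_scaleR_right: "rinner x (c *\<^sub>R y) = c * rinner x y"
  by (metis rinner_scaleR_left rinner_commute)

lemma rinner_zero: "rinner 0 x = 0" "rinner x 0 = 0"
  by (simp_all add: rinner_def cinner_zero)

lemma Cauchy_Schwarz_rinner: "rinner x y \<le> norm x * norm y"
proof (cases "norm x * norm y = 0")
  case True
  then show ?thesis by (auto simp: rinner_zero)
next
  case False
  define s t where "s = norm y" and "t = norm x"
  have st: "s > 0" "t > 0" using False by (auto simp: s_def t_def)
  have "0 \<le> (norm (s *\<^sub>R x + (- t) *\<^sub>R y))\<^sup>2" by simp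
  also have "\<dots> = s\<^sup>2 * t\<^sup>2 - 2 * s * t * rinner x y + t\<^sup>2 * s\<^sup>2"
    unfolding rinner_self[symmetric] rinner_add_left rinner_add_right rinner_scaleR_left rinner_scaleR_right
    by (simp only: rinner_self rinner_commute[of y x]) (simp add: s_def t_def algebra_simps power2_eq_square)
  finally have "(s * t) * rinner x y \<le> (s * t) * (s * t)"
    by (simp add: power2_eq_square algebra_simps)
  then show ?thesis using st by (simp add: s_def t_def mult.commute)
qed

lemma bounded_bilinear_rinner: "bounded_bilinear (rinner :: 'a::complex_inner \<Rightarrow> _)"
proof
  show "\<exists>K. \<forall>(a::'a) b. norm (rinner a b) \<le> norm a * norm b * K"
  proof (intro exI[of _ 1] allI)
    fix a b :: 'a
    have "rinner (- a) b \<le> norm a * norm b" "rinner a b \<le> norm a * norm b"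
      using Cauchy_Schwarz_rinner[of "- a" b] Cauchy_Schwarz_rinner[of a b] by auto
    then show "norm (rinner a b) \<le> norm a * norm b * 1"
      using rinner_scaleR_left[of "-1" a b] by simp
  qed
qed (simp_all add: rinner_add_left rinner_add_right rinner_scaleR_left rinner_scaleR_right)

interpretation rinner: bounded_bilinear rinner
  by (rule bounded_bilinear_rinner)

lemma bop_apply_scaleR: "bop_apply (c *\<^sub>R X) x = c *\<^sub>R bop_apply X x"
  "bop_apply X (c *\<^sub>R x) = c *\<^sub>R bop_apply X x"
  by (transfer; simp add: blinfun.bilinear_simps)+

lemma bop_apply_mult: "bop_apply (X * Y) x = bop_apply X (bop_apply Y x)"
  by transfer simp

lemma bop_apply_one: "bop_apply 1 x = x"
  by transfer simp

lemma bop_apply_diff: "bop_apply X (x - y) = bop_apply X x - bop_apply X y"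
  "bop_apply X (- y) = - bop_apply X y"
  by (transfer; simp add: blinfun.bilinear_simps)+

lemma bop_apply_scaleC: "bop_apply X (c *\<^sub>C x) = c *\<^sub>C bop_apply X x"
  by transfer simp

lemmas bop_simps = bop_apply_simps bop_apply_scaleR bop_apply_mult bop_apply_one bop_apply_diff

lemma norm_bop_apply: "norm (bop_apply X x) \<le> norm X * norm x"
  by transfer (rule norm_blinfun)

lemma norm_bop_bound: "0 \<le> b \<Longrightarrow> (\<And>x. norm (bop_apply X x) \<le> b * norm x) \<Longrightarrow> norm X \<le> b"
  by transfer (rule norm_blinfun_bound)

lemma norm_bop_one: "norm (1 :: 'a::complex_inner bop) \<le> 1"
  by (rule norm_bop_bound) (simp_all add: bop_apply_one)

lemma bounded_linear_bop_apply: "bounded_linear (\<lambda>X. bop_apply X x)"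
  by (rule bounded_linear_intro[where K = "norm x"])
    (simp_all add: bop_simps norm_bop_apply)

text \<open>
  The imaginary part of \<open>cinner u v\<close> is \<open>- rinner (\<i> *\<^sub>C u) v\<close>, and a bounded operator commutes with
  multiplication by \<open>\<i>\<close>.  So the real parts carry all the information.
\<close>

lemma selfadjoint_iff: "selfadjoint X \<longleftrightarrow> (\<forall>x y. rinner (bop_apply X x) y = rinner x (bop_apply X y))"
proof
  assume *: "\<forall>x y. rinner (bop_apply X x) y = rinner x (bop_apply X y)"
  have Im: "Im (cinner u v) = - rinner (\<i> *\<^sub>C u) v" for u v :: 'a
    by (simp add: rinner_def cinner_scaleC_left)
  have "Im (cinner (bop_apply X x) y) = Im (cinner x (bop_apply X y))" for x y
    by (simp add: Im * flip: bop_apply_scaleC)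
  moreover have "Re (cinner (bop_apply X x) y) = Re (cinner x (bop_apply X y))" for x y
    using * by (simp add: rinner_def)
  ultimately show "selfadjoint X"
    by (simp add: selfadjoint_def complex_eq_iff)
qed (simp add: selfadjoint_def rinner_def)

lemma selfadjointD: "selfadjoint X \<Longrightarrow> rinner (bop_apply X x) y = rinner x (bop_apply X y)"
  by (simp add: selfadjoint_iff)

lemma le_bop_iff: "X \<le> Y \<longleftrightarrow> selfadjoint (Y - X) \<and> (\<forall>x. rinner (bop_apply X x) x \<le> rinner (bop_apply Y x) x)"
  by (simp add: less_eq_bop_def positive_op_def bop_simps rinner.diff_left flip: rinner_def)

lemma zero_le_bop_iff: "0 \<le> X \<longleftrightarrow> selfadjoint X \<and> (\<forall>x. 0 \<le> rinner (bop_apply X x) x)"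
  by (simp add: le_bop_iff bop_simps rinner_zero)

lemma selfadjoint_zero [simp]: "selfadjoint 0"
  and selfadjoint_one [simp]: "selfadjoint 1"
  and selfadjoint_add: "selfadjoint X \<Longrightarrow> selfadjoint Y \<Longrightarrow> selfadjoint (X + Y)"
  and selfadjoint_diff: "selfadjoint X \<Longrightarrow> selfadjoint Y \<Longrightarrow> selfadjoint (X - Y)"
  and selfadjoint_scaleR: "selfadjoint X \<Longrightarrow> selfadjoint (c *\<^sub>R X)"
  by (simp_all add: selfadjoint_iff bop_simps rinner.add_left rinner.add_right
      rinner.diff_left rinner.diff_right rinner.scaleR_left rinner.scaleR_right rinner_zero)

lemma selfadjoint_sandwich: "selfadjoint C \<Longrightarrow> selfadjoint X \<Longrightarrow> selfadjoint (C * X * C)"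
  by (simp add: selfadjoint_iff bop_simps)

lemma selfadjoint_mult: "selfadjoint X \<Longrightarrow> selfadjoint Y \<Longrightarrow> X * Y = Y * X \<Longrightarrow> selfadjoint (X * Y)"
  unfolding selfadjoint_iff
  by (metis bop_apply_mult)

lemma selfadjoint_power: "selfadjoint X \<Longrightarrow> selfadjoint (X ^ n)"
  by (induction n) (auto intro: selfadjoint_mult simp: power_commutes)

lemma selfadjoint_sum: "(\<And>i. i \<in> I \<Longrightarrow> selfadjoint (f i)) \<Longrightarrow> selfadjoint (sum f I)"
  by (induction I rule: infinite_finite_induct) (auto intro: selfadjoint_add)

lemma selfadjoint_of_le:
  "0 \<le> X \<Longrightarrow> selfadjoint X"
  "c *\<^sub>R 1 \<le> X \<Longrightarrow> selfadjoint X"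
  using selfadjoint_add[of "X - c *\<^sub>R 1" "c *\<^sub>R 1"]
  by (auto simp: le_bop_iff selfadjoint_scaleR)

lemma sandwich_mono:
  assumes "selfadjoint C" "X \<le> Y" shows "C * X * C \<le> C * Y * C"
proof -
  have "selfadjoint (C * (Y - X) * C)"
    using assms by (intro selfadjoint_sandwich) (auto simp: le_bop_iff)
  then show ?thesis
    using assms by (simp add: le_bop_iff algebra_simps bop_apply_mult selfadjointD[symmetric])
      (simp add: selfadjointD)
qed

instance bop :: (complex_inner) ordered_real_vector
proof
  fix c d :: real and X Y :: "'a bop"
  have *: "c *\<^sub>R X \<le> c *\<^sub>R Y" if "X \<le> Y" "0 \<le> c" for c and X Y :: "'a bop"
    using that by (auto simp: le_bop_iff bop_simps rinner.scaleR_left mult_left_mono selfadjoint_scaleR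
      simp flip: scaleR_diff_right)
  show "c *\<^sub>R X \<le> c *\<^sub>R Y" if "X \<le> Y" "0 \<le> c"
    using that by (rule *)
  show "c *\<^sub>R X \<le> d *\<^sub>R X" if "c \<le> d" "0 \<le> X"
    using *[of 0 X "d - c"] that by (simp add: scaleR_diff_left)
qed

lemma scaleR_one_mono: "a \<le> b \<Longrightarrow> a *\<^sub>R (1 :: 'a::complex_inner bop) \<le> b *\<^sub>R 1"
  by (auto simp: le_bop_iff bop_simps rinner.scaleR_left mult_right_mono rinner_self selfadjoint_scaleR
      simp flip: scaleR_diff_left)

lemma square_nonneg: "selfadjoint X \<Longrightarrow> 0 \<le> X * (X :: 'a::complex_inner bop)"
  by (auto simp: zero_le_bop_iff bop_apply_mult selfadjointD rinner_self intro: selfadjoint_mult)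

lemma selfadjoint_le_norm:
  assumes "selfadjoint X" shows "X \<le> norm X *\<^sub>R 1"
proof -
  have "rinner (bop_apply X x) x \<le> norm X * (norm x)\<^sup>2" for x
    using Cauchy_Schwarz_rinner[of "bop_apply X x" x]
      mult_right_mono[OF norm_bop_apply[of X x] norm_ge_zero[of x]]
    by (simp add: power2_eq_square)
  then show ?thesis
    using assms by (simp add: le_bop_iff bop_simps rinner.scaleR_left rinner_self selfadjoint_diff selfadjoint_scaleR)
qed

text \<open>
  By polarization the form of \<open>K\<close> at \<open>x\<close> and \<open>y\<close> is a quarter of the difference of its values at
  \<open>x + y\<close> and \<open>x - y\<close>, so the parallelogram law bounds it by \<open>k\<close> times the mean of the squared norms
  of \<open>x\<close> and \<open>y\<close>.  The best choice is \<open>y\<close> proportional to the image of \<open>x\<close>.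
\<close>

lemma norm_le_of_between:
  assumes le: "- (k *\<^sub>R 1) \<le> K" "K \<le> k *\<^sub>R (1 :: 'a::complex_inner bop)" and k: "0 \<le> k"
  shows "norm K \<le> k"
proof (cases "k = 0")
  case True
  then show ?thesis using le by simp
next
  case False
  with k have k: "k > 0" by simp
  have sa: "selfadjoint K"
    using selfadjoint_of_le(2)[of "-k" K] le by simp
  have up: "rinner (bop_apply K x) x \<le> k * (norm x)\<^sup>2" and lo: "- (k * (norm x)\<^sup>2) \<le> rinner (bop_apply K x) x" for x
    using le by (simp_all add: le_bop_iff bop_simps rinner.scaleR_left rinner.minus_left rinner_self)
  have pol: "4 * rinner (bop_apply K x) y \<le> 2 * k * ((norm x)\<^sup>2 + (norm y)\<^sup>2)" for x y
  proof -
    have "4 * rinner (bop_apply K x) y =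
      rinner (bop_apply K (x + y)) (x + y) - rinner (bop_apply K (x - y)) (x - y)"
      using selfadjointD[OF sa, of y x] rinner_commute[of y "bop_apply K x"]
      by (simp add: bop_simps rinner.add_left rinner.add_right rinner.diff_left rinner.diff_right)
    also have "\<dots> \<le> k * ((norm (x + y))\<^sup>2 + (norm (x - y))\<^sup>2)"
      using up[of "x + y"] lo[of "x - y"] by (simp add: distrib_left)
    also have "(norm (x + y))\<^sup>2 + (norm (x - y))\<^sup>2 = 2 * ((norm x)\<^sup>2 + (norm y)\<^sup>2)"
      using rinner_commute[of x y]
      by (simp add: rinner_self[symmetric] rinner.add_left rinner.add_right rinner.diff_left rinner.diff_right)
    finally show ?thesis by (simp only: mult.assoc mult.left_commute)
  qed
  have "norm (bop_apply K x) \<le> k * norm x" for x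
  proof -
    let ?n = "norm (bop_apply K x)"
    have "rinner (bop_apply K x) ((1/k) *\<^sub>R bop_apply K x) = ?n\<^sup>2 / k"
      by (simp add: rinner.scaleR_right rinner_self)
    moreover have "(norm ((1/k) *\<^sub>R bop_apply K x))\<^sup>2 = ?n\<^sup>2 / k\<^sup>2"
      using k by (simp add: power_divide)
    ultimately have "4 * (?n\<^sup>2 / k) \<le> 2 * k * ((norm x)\<^sup>2 + ?n\<^sup>2 / k\<^sup>2)"
      using pol[of x "(1/k) *\<^sub>R bop_apply K x"] by simp
    also have "\<dots> = 2 * k * (norm x)\<^sup>2 + 2 * (?n\<^sup>2 / k)"
      using k by (simp add: distrib_left power2_eq_square)
    finally have "?n\<^sup>2 / k \<le> k * (norm x)\<^sup>2" by simp
    then have "?n\<^sup>2 \<le> (k * norm x)\<^sup>2"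
      using k by (simp add: divide_le_eq power_mult_distrib power2_eq_square mult_ac)
    then show ?thesis by (rule power2_le_imp_le) (use k in simp)
  qed
  with k show ?thesis by (intro norm_bop_bound) auto
qed

lemma between_norm:
  assumes "selfadjoint X" shows "- (norm X *\<^sub>R 1) \<le> X" "X \<le> norm X *\<^sub>R 1"
proof -
  have "selfadjoint (- X)" using selfadjoint_scaleR[OF assms, of "-1"] by simp
  from selfadjoint_le_norm[OF this] have "- X \<le> norm X *\<^sub>R 1" by simp
  then show "- (norm X *\<^sub>R 1) \<le> X" by (simp only: minus_le_iff)
qed (rule selfadjoint_le_norm[OF assms])

lemma norm_square_selfadjoint:
  assumes "selfadjoint X" shows "norm (X * X) = (norm X)\<^sup>2"
proof (rule antisym)
  show "norm (X * X) \<le> (norm X)\<^sup>2" by (simp add: norm_mult_ineq power2_eq_square)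
  have "norm X \<le> sqrt (norm (X * X))"
  proof (rule norm_bop_bound)
    fix x
    have "(norm (bop_apply X x))\<^sup>2 = rinner (bop_apply (X * X) x) x"
      using assms by (simp add: bop_apply_mult selfadjointD rinner_self[symmetric])
    also have "\<dots> \<le> norm (X * X) * (norm x)\<^sup>2"
      using selfadjoint_le_norm[of "X * X"] selfadjoint_mult[OF assms assms refl]
      by (simp add: le_bop_iff bop_apply_scaleR bop_apply_one rinner.scaleR_left rinner_self)
    finally have "norm (bop_apply X x) \<le> sqrt (norm (X * X) * (norm x)\<^sup>2)"
      by (rule real_le_rsqrt)
    then show "norm (bop_apply X x) \<le> sqrt (norm (X * X)) * norm x"
      by (simp add: real_sqrt_mult)
  qed simp
  then show "(norm X)\<^sup>2 \<le> norm (X * X)"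
    using power_mono[of "norm X" "sqrt (norm (X * X))" 2] by simp
qed

text \<open>
  The positive operators form a closed cone; this is how inequalities pass to limits below.
\<close>

lemma le_add_eps_imp_le:
  assumes "selfadjoint X" "selfadjoint Y" "\<And>e. e > 0 \<Longrightarrow> X \<le> Y + e *\<^sub>R (1 :: 'a::complex_inner bop)"
  shows "X \<le> Y"
proof -
  have "rinner (bop_apply X x) x \<le> rinner (bop_apply Y x) x" for x
  proof (rule field_le_epsilon)
    fix e :: real assume e: "e > 0"
    define d where "d = e / ((norm x)\<^sup>2 + 1)"
    have n: "(norm x)\<^sup>2 + 1 > 0" by (simp add: add_nonneg_pos)
    have "d > 0" using e n by (simp add: d_def)
    have "d * (norm x)\<^sup>2 \<le> e" using e n by (simp add: d_def field_simps)
    with assms(3)[OF \<open>d > 0\<close>] show "rinner (bop_apply X x) x \<le> rinner (bop_apply Y x) x + e"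
      by (auto simp add: le_bop_iff bop_simps rinner.add_left rinner.scaleR_left rinner_self
        dest!: spec[of _ x])
  qed
  then show ?thesis using assms by (simp add: le_bop_iff selfadjoint_diff)
qed

instance chilbert \<subseteq> banach ..

text \<open>
  The operators that commute with every complex scalar are closed among all bounded real-linear
  ones.  Completeness is needed for Neumann series and for the limits that define functional calculus.
\<close>

instance bop :: (chilbert) banach
proof
  fix X :: "nat \<Rightarrow> 'a bop"
  assume C: "Cauchy X"
  have "Cauchy (\<lambda>n. Rep_bop (X n))"
    using C by (simp only: Cauchy_def dist_norm norm_bop.rep_eq minus_bop.rep_eq)
  then obtain L where L: "(\<lambda>n. Rep_bop (X n)) \<longlonglongrightarrow> L"
    by (auto simp: Cauchy_convergent_iff convergent_def)
  have lim: "(\<lambda>n. bop_apply (X n) x) \<longlonglongrightarrow> blinfun_apply L x" for x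
    unfolding bop_apply.rep_eq by (intro tendsto_intros L)
  have "blinfun_apply L (c *\<^sub>C x) = c *\<^sub>C blinfun_apply L x" for c x
  proof (rule LIMSEQ_unique[OF lim])
    show "(\<lambda>n. bop_apply (X n) (c *\<^sub>C x)) \<longlonglongrightarrow> c *\<^sub>C blinfun_apply L x"
      unfolding bop_apply_scaleC by (intro bounded_linear.tendsto[OF bounded_linear_scaleC] lim)
  qed
  then have R: "Rep_bop (Abs_bop L) = L"
    by (intro Abs_bop_inverse) simp
  have "X \<longlonglongrightarrow> Abs_bop L"
    using L unfolding tendsto_iff dist_norm norm_bop.rep_eq minus_bop.rep_eq R .
  then show "convergent X" by (auto simp: convergent_def)
qed

section \<open>Invertibility of operators bounded below\<close>

lemma inv_op_eqI:
  assumes "X * Y = 1" "Y * X = 1" shows "inv_op X = Y"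
  unfolding inv_op_def
proof (rule the_equality)
  show "Z = Y" if "X * Z = 1 \<and> Z * X = 1" for Z
    using assms that by (metis mult.assoc mult_1 mult_1_right)
qed (use assms in simp)

lemma invertible_op_mult: "invertible_op X \<Longrightarrow> invertible_op Y \<Longrightarrow> invertible_op (X * Y)"
  unfolding invertible_op_def by (metis mult.assoc mult_1_right)

lemma invertible_op_scaleR: 
  assumes "c \<noteq> 0" "invertible_op X" shows "invertible_op (c *\<^sub>R X)"
proof -
  obtain Y where "X * Y = 1" "Y * X = 1" using assms by (auto simp: invertible_op_def)
  then show ?thesis
    using assms by (auto simp: invertible_op_def intro!: exI[of _ "inverse c *\<^sub>R Y"])
qed

lemma norm_bop_power: "norm (X ^ n) \<le> norm (X :: 'a::complex_inner bop) ^ n"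
proof (induction n)
  case (Suc n)
  have "norm (X * X ^ n) \<le> norm X * norm (X ^ n)" by (rule norm_mult_ineq)
  also have "\<dots> \<le> norm X * norm X ^ n" by (intro mult_left_mono Suc) simp
  finally show ?case by simp
qed (simp add: norm_bop_one)

lemma invertible_op_one_minus:
  fixes K :: "'a::chilbert bop"
  assumes "norm K < 1" shows "invertible_op (1 - K)"
proof -
  have s: "summable (\<lambda>n. K ^ n)"
    by (rule summable_comparison_test'[of "\<lambda>n. norm K ^ n" 0])
      (use assms in \<open>auto simp: norm_bop_power summable_geometric\<close>)
  define S where "S = (\<Sum>n. K ^ n)"
  have 1: "S = 1 + (\<Sum>n. K ^ Suc n)" using suminf_split_head[OF s] by (simp add: S_def)
  have "(\<Sum>n. K ^ Suc n) = K * S"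
    using bounded_linear.suminf[OF bounded_linear_mult_right s, of K] by (simp add: S_def)
  with 1 have "S - K * S = 1" by (metis add_diff_cancel_right')
  moreover have "(\<Sum>n. K ^ Suc n) = S * K"
    using bounded_linear.suminf[OF bounded_linear_mult_left s, of K] by (simp only: power_Suc2 S_def)
  with 1 have "S - S * K = 1" by (metis add_diff_cancel_right')
  ultimately show ?thesis
    by (auto simp: invertible_op_def left_diff_distrib right_diff_distrib intro!: exI[of _ S])
qed

text \<open>
  If \<open>c \<le> S \<le> d\<close> then \<open>S = d (1 - K)\<close> with \<open>0 \<le> K \<le> 1 - c/d\<close>, and a Neumann series inverts \<open>1 - K\<close>.
\<close>

lemma invertible_op_of_ge:
  fixes S :: "'a::chilbert bop"
  assumes c: "0 < c" and S: "c *\<^sub>R 1 \<le> S" shows "invertible_op S"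
proof -
  define d where "d = norm S + c"
  have d: "d > 0" "c \<le> d" using c by (auto simp: d_def add_nonneg_pos)
  have sa: "selfadjoint S" using S by (rule selfadjoint_of_le)
  have S': "S \<le> d *\<^sub>R 1"
    using selfadjoint_le_norm[OF sa] scaleR_one_mono[of "norm S" d] c by (auto simp: d_def intro: order_trans)
  define K where "K = 1 - (1/d) *\<^sub>R S"
  have "(c/d) *\<^sub>R 1 \<le> (1/d) *\<^sub>R S" "(1/d) *\<^sub>R S \<le> 1"
    using scaleR_left_mono[OF S, of "1/d"] scaleR_left_mono[OF S', of "1/d"] d by simp_all
  then have K: "0 \<le> K" "K \<le> (1 - c/d) *\<^sub>R 1"
    by (simp_all add: K_def scaleR_diff_left)
  have "norm K \<le> 1 - c/d"
  proof (rule norm_le_of_between[OF _ K(2)])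
    show "0 \<le> 1 - c / d" using d by simp
    then have "- ((1 - c / d) *\<^sub>R 1) \<le> (0 :: 'a bop)"
      using scaleR_one_mono[of 0 "1 - c/d", where 'a = 'a] by simp
    then show "- ((1 - c / d) *\<^sub>R 1) \<le> K" using K(1) by (rule order_trans)
  qed
  also have "\<dots> < 1" using c d by simp
  finally have "invertible_op (d *\<^sub>R (1 - K))"
    using d by (intro invertible_op_scaleR invertible_op_one_minus) auto
  also have "d *\<^sub>R (1 - K) = S" using d by (simp add: K_def)
  finally show ?thesis .
qed

text \<open>
  For \<open>u = R x\<close>, invertibility bounds \<open>\<parallel>x\<parallel>\<close> by a multiple of \<open>\<parallel>u\<parallel>\<close>, and positivity bounds \<open>\<parallel>u\<parallel>\<^sup>2\<close> by a multiple
  of the quadratic form of \<open>R\<close> at \<open>x\<close>: the form is nonnegative at \<open>x - t u\<close>, and \<open>t = 1/k\<close> with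
  \<open>R \<le> k\<close> gives the bound.
\<close>

lemma invertible_nonneg_ge:
  fixes R :: "'a::complex_inner bop"
  assumes "0 \<le> R" "invertible_op R"
  shows "\<exists>e>0. e *\<^sub>R 1 \<le> R"
proof -
  obtain Y where Y: "Y * R = 1" using assms by (auto simp: invertible_op_def)
  define k l where "k = norm R + 1" and "l = norm Y + 1"
  have kl: "k > 0" "l > 0" by (simp_all add: k_def l_def add_nonneg_pos)
  have sa: "selfadjoint R" using assms zero_le_bop_iff by auto
  have "1 / (k * l\<^sup>2) * (norm x)\<^sup>2 \<le> rinner (bop_apply R x) x" for x
  proof -
    define u where "u = bop_apply R x"
    have ru: "rinner (bop_apply R u) u \<le> k * (norm u)\<^sup>2"
    proof -
      have "rinner (bop_apply R u) u \<le> norm R * (norm u)\<^sup>2"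
        using selfadjoint_le_norm[OF sa] by (simp add: le_bop_iff bop_simps rinner.scaleR_left rinner_self)
      then show ?thesis by (rule order_trans) (simp add: k_def mult_right_mono)
    qed
    have "0 \<le> rinner (bop_apply R (x - (1/k) *\<^sub>R u)) (x - (1/k) *\<^sub>R u)"
      using assms(1) by (simp add: zero_le_bop_iff)
    also have "\<dots> = rinner (bop_apply R x) x - 2 * ((1/k) * (norm u)\<^sup>2) + (1/k) * ((1/k) * rinner (bop_apply R u) u)"
      using selfadjointD[OF sa, of u x]
      by (simp add: bop_simps rinner.diff_left rinner.diff_right rinner.scaleR_left rinner.scaleR_right
          rinner_self u_def[symmetric] diff_divide_distrib)
    also have "\<dots> \<le> rinner (bop_apply R x) x - 2 * ((1/k) * (norm u)\<^sup>2) + (1/k) * ((1/k) * (k * (norm u)\<^sup>2))"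
      using kl ru by (intro add_mono mult_left_mono) auto
    also have "\<dots> = rinner (bop_apply R x) x - (1/k) * (norm u)\<^sup>2" using kl by simp
    finally have 1: "(1/k) * (norm u)\<^sup>2 \<le> rinner (bop_apply R x) x" by simp
    have "x = bop_apply Y u" unfolding u_def by (metis Y bop_apply_mult bop_apply_one)
    then have "norm x \<le> norm Y * norm u" using norm_bop_apply by metis
    also have "\<dots> \<le> l * norm u" by (simp add: l_def mult_right_mono)
    finally have "(norm x)\<^sup>2 \<le> l\<^sup>2 * (norm u)\<^sup>2"
      using power_mono[of "norm x" "l * norm u" 2] by (simp add: power_mult_distrib)
    then have "1 / (k * l\<^sup>2) * (norm x)\<^sup>2 \<le> 1 / (k * l\<^sup>2) * (l\<^sup>2 * (norm u)\<^sup>2)"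
      using kl by (intro mult_left_mono) auto
    also have "\<dots> = (1/k) * (norm u)\<^sup>2" using kl by simp
    finally show ?thesis using 1 by simp
  qed
  then show ?thesis using kl
    by (intro exI[of _ "1 / (k * l\<^sup>2)"] conjI)
      (simp, simp add: le_bop_iff bop_simps rinner.scaleR_left rinner_self sa selfadjoint_diff selfadjoint_scaleR)
qed

section \<open>Polynomials of a self-adjoint operator\<close>

lemma poly_op_altdef:
  assumes "degree q \<le> N" shows "poly_op q X = (\<Sum>i\<le>N. coeff q i *\<^sub>R X ^ i)"
  unfolding poly_op_def using assms by (intro sum.mono_neutral_left) (auto simp: coeff_eq_0)

lemma poly_op_pCons: "poly_op (pCons a p) X = a *\<^sub>R 1 + X * poly_op p X"
proof -
  have "poly_op (pCons a p) X = (\<Sum>i\<le>Suc (degree p). coeff (pCons a p) i *\<^sub>R X ^ i)"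
    by (rule poly_op_altdef) (simp add: degree_pCons_le)
  also have "\<dots> = a *\<^sub>R 1 + (\<Sum>i\<le>degree p. coeff p i *\<^sub>R (X * X ^ i))"
    by (subst sum.atMost_Suc_shift) simp
  finally show ?thesis by (simp add: poly_op_def sum_distrib_left)
qed

lemma poly_op_zero [simp]: "poly_op 0 X = 0"
  by (simp add: poly_op_def)

lemma poly_op_add: "poly_op (p + q) X = poly_op p X + poly_op q X"
proof -
  let ?N = "max (degree p) (degree q)"
  have "poly_op (p + q) X = (\<Sum>i\<le>?N. coeff (p + q) i *\<^sub>R X ^ i)"
    by (rule poly_op_altdef) (simp add: degree_add_le)
  then show ?thesis
    by (simp add: poly_op_altdef[of p ?N] poly_op_altdef[of q ?N] scaleR_add_left sum.distrib)
qed

lemma poly_op_smult: "poly_op (smult c p) X = c *\<^sub>R poly_op p X"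
  by (simp add: poly_op_altdef[of "smult c p" "degree p"] degree_smult_le poly_op_def scaleR_sum_right)

lemma poly_op_mult: "poly_op (p * q) X = poly_op p X * poly_op q X"
  by (induction p) (simp_all add: poly_op_add poly_op_smult poly_op_pCons distrib_right mult.assoc)

lemma poly_op_diff: "poly_op (p - q) X = poly_op p X - poly_op q X"
  using poly_op_add[of p "smult (-1) q" X] poly_op_smult[of "-1" q X] by simp

lemma poly_op_const [simp]: "poly_op [:c:] X = c *\<^sub>R 1"
  by (simp add: poly_op_pCons)

lemma selfadjoint_poly_op: "selfadjoint X \<Longrightarrow> selfadjoint (poly_op p X)"
  unfolding poly_op_def by (intro selfadjoint_sum selfadjoint_scaleR selfadjoint_power)

definition real_spectrum :: "'a::complex_inner bop \<Rightarrow> real set"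
  where "real_spectrum X = {t. complex_of_real t \<in> spectrum_op X}"

lemma real_spectrum_iff: "t \<in> real_spectrum X \<longleftrightarrow> \<not> invertible_op (t *\<^sub>R 1 - X)"
  by (simp add: real_spectrum_def spectrum_op_def scaleR_scaleC)

text \<open>
  A complex root that is real gives a linear factor.  If a root is not real, division by its real
  quadratic leaves a remainder of degree less than two that vanishes at a non-real point, hence is zero.
\<close>

lemma real_poly_factor:
  fixes q :: "real poly"
  assumes "degree q \<noteq> 0"
  shows "(\<exists>t r. q = [:-t, 1:] * r) \<or> (\<exists>a b r. b \<noteq> 0 \<and> q = ([:-a, 1:] * [:-a, 1:] + [:b\<^sup>2:]) * r)"
proof -
  define ev where "ev = (\<lambda>z (p :: real poly). poly (map_poly complex_of_real p) z)"
  have ev_pCons: "ev z (pCons c p) = of_real c + z * ev z p" for z c p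
    by (simp add: ev_def map_poly_pCons)
  have ev_0: "ev z 0 = 0" for z by (simp add: ev_def)
  have ev_add: "ev z (p + p') = ev z p + ev z p'" for z p p'
  proof -
    have "map_poly complex_of_real (p + p') = map_poly complex_of_real p + map_poly complex_of_real p'"
      by (rule poly_eqI) (simp add: coeff_map_poly)
    then show ?thesis by (simp add: ev_def)
  qed
  have ev_smult: "ev z (smult c p) = of_real c * ev z p" for z c p
    by (simp add: ev_def map_poly_smult)
  have ev_mult: "ev z (p * p') = ev z p * ev z p'" for z p p'
    by (induction p) (simp_all add: ev_0 ev_add ev_smult ev_pCons distrib_right)
  have ev_real: "ev (of_real t) p = of_real (poly p t)" for t p
    by (induction p) (simp_all add: ev_0 ev_pCons)
  have "degree (map_poly complex_of_real q) = degree q" by (rule degree_map_poly) simp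
  then have "\<not> constant (poly (map_poly complex_of_real q))"
    using assms by (simp add: constant_degree)
  then obtain z where z: "ev z q = 0"
    using fundamental_theorem_of_algebra unfolding ev_def by blast
  show ?thesis
  proof (cases "Im z = 0")
    case True
    then have "z = of_real (Re z)" by (simp add: complex_eq_iff)
    then have "poly q (Re z) = 0" using z ev_real[of "Re z" q] by simp
    then show ?thesis by (auto simp: poly_eq_0_iff_dvd dvd_def)
  next
    case False
    define d where "d = [:- Re z, 1:] * [:- Re z, 1:] + [:(Im z)\<^sup>2:]"
    have ev_d: "ev z d = 0"
      by (simp add: d_def ev_0 ev_add ev_mult ev_pCons complex_eq_iff power2_eq_square)
    have dd: "degree d = 2" by (simp add: d_def)
    \<comment> \<open>\<open>d\<close> is the real quadratic with roots \<open>z\<close> and its conjugate.\<close>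
    define r where "r = q mod d"
    have q: "q = d * (q div d) + r" by (simp add: r_def)
    have "ev z r = 0" using z ev_add[of z "d * (q div d)" r] ev_mult[of z d] ev_d q by simp
    have "d \<noteq> 0" using dd by auto
    then have "degree r < 2 \<or> r = 0" using degree_mod_less[of d q] dd by (auto simp: r_def)
    then obtain c0 c1 where r: "r = [:c0, c1:]"
      by (metis One_nat_def degree_pCons_eq_if less_2_cases degree_eq_zeroE pCons_0_0 pCons_cases
          Suc_inject nat.distinct(1))
    from \<open>ev z r = 0\<close> have "c1 = 0" "c0 = 0"
      using False by (auto simp: r ev_pCons ev_0 complex_eq_iff)
    then have "q = d * (q div d)" using q r by simp
    with False show ?thesis unfolding d_def by blast
  qed
qed

text \<open>
  One half of the spectral mapping theorem, by splitting off real factors one at a time.  A linear factor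
  is invertible because its root is outside the spectrum; a quadratic factor
  \<open>(T - a)\<^sup>2 + b\<^sup>2\<close> is invertible because it is at least \<open>b\<^sup>2\<close>.  So only real points of the spectrum matter.
\<close>

lemma invertible_poly_op:
  fixes T :: "'a::chilbert bop"
  assumes T: "selfadjoint T" and "q \<noteq> 0" "\<And>t. t \<in> real_spectrum T \<Longrightarrow> poly q t \<noteq> 0"
  shows "invertible_op (poly_op q T)"
  using assms(2-)
proof (induction "degree q" arbitrary: q rule: less_induct)
  case less
  show ?case
  proof (cases "degree q = 0")
    case True
    then obtain c where "q = [:c:]" by (rule degree_eq_zeroE)
    moreover have "invertible_op (1 :: 'a bop)" by (auto simp: invertible_op_def)
    ultimately show ?thesis using less.prems by (auto intro!: invertible_op_scaleR)
  next
    case False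
    have *: ?thesis if q: "q = d * r" and d: "degree d \<noteq> 0" and inv: "invertible_op (poly_op d T)" for d r
    proof -
      have "d \<noteq> 0" "r \<noteq> 0" using q less.prems by auto
      then have "degree r < degree q" using q d by (simp add: degree_mult_eq)
      then have "invertible_op (poly_op r T)"
        using less.prems q \<open>r \<noteq> 0\<close> by (intro less.hyps) auto
      then show ?thesis unfolding q poly_op_mult by (intro invertible_op_mult inv)
    qed
    from real_poly_factor[OF False] show ?thesis
    proof (elim disjE exE conjE)
      fix t r assume q: "q = [:-t, 1:] * r"
      then have "t \<notin> real_spectrum T" using less.prems by auto
      then have "invertible_op ((-1) *\<^sub>R (t *\<^sub>R 1 - T))"
        by (intro invertible_op_scaleR) (auto simp: real_spectrum_iff)
      then show ?thesis by (intro *[OF q]) (auto simp: poly_op_pCons)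
    next
      fix a b r assume b: "b \<noteq> 0" and q: "q = ([:-a, 1:] * [:-a, 1:] + [:b\<^sup>2:]) * r"
      have "0 \<le> poly_op [:-a, 1:] T * poly_op [:-a, 1:] T"
        by (intro square_nonneg selfadjoint_poly_op T)
      then have "b\<^sup>2 *\<^sub>R 1 \<le> poly_op ([:-a, 1:] * [:-a, 1:] + [:b\<^sup>2:]) T"
        by (simp only: poly_op_add poly_op_mult poly_op_const le_add_same_cancel2)
      then show ?thesis using b by (intro *[OF q] invertible_op_of_ge[of "b\<^sup>2"]) auto
    qed
  qed
qed

text \<open>
  The operator is nonnegative, so if it were invertible it would be at least some \<open>e > 0\<close>; then
  \<open>S * S \<le> \<parallel>S\<parallel>\<^sup>2 - e\<close>, against \<open>\<parallel>S * S\<parallel> = \<parallel>S\<parallel>\<^sup>2\<close>.  The zero space, where \<open>1 = 0\<close>, is the only exception.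
\<close>

lemma norm_square_minus_square_not_invertible:
  fixes S :: "'a::complex_inner bop"
  assumes sa: "selfadjoint S" and nz: "(1 :: 'a bop) \<noteq> 0"
  shows "\<not> invertible_op ((norm S)\<^sup>2 *\<^sub>R 1 - S * S)"
proof
  define l where "l = norm S"
  assume "invertible_op ((norm S)\<^sup>2 *\<^sub>R 1 - S * S)"
  moreover have nn: "norm (S * S) = l\<^sup>2" by (simp add: norm_square_selfadjoint sa l_def)
  have "selfadjoint (S * S)" by (simp add: selfadjoint_mult sa)
  from selfadjoint_le_norm[OF this] have "0 \<le> (norm S)\<^sup>2 *\<^sub>R 1 - S * S"
    by (simp add: nn l_def)
  ultimately obtain e where e: "e > 0" "e *\<^sub>R 1 \<le> l\<^sup>2 *\<^sub>R 1 - S * S"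
    using invertible_nonneg_ge l_def by blast
  then have up: "S * S \<le> (l\<^sup>2 - e) *\<^sub>R 1" by (simp add: algebra_simps)
  show False
  proof (cases "e \<le> l\<^sup>2")
    case True
    have "norm (S * S) \<le> l\<^sup>2 - e"
    proof (rule norm_le_of_between[OF _ up])
      have "- ((l\<^sup>2 - e) *\<^sub>R 1) \<le> (0 :: 'a bop)"
        using scaleR_one_mono[of 0 "l\<^sup>2 - e", where 'a = 'a] True by simp
      then show "- ((l\<^sup>2 - e) *\<^sub>R 1) \<le> S * S" using square_nonneg[OF sa] by (rule order_trans)
    qed (use True in simp)
    with nn e show False by simp
  next
    case False
    have "0 \<le> (l\<^sup>2 - e) *\<^sub>R (1 :: 'a bop)" using square_nonneg[OF sa] up by (rule order_trans)
    moreover have "(l\<^sup>2 - e) *\<^sub>R (1 :: 'a bop) \<le> 0"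
      using scaleR_one_mono[of "l\<^sup>2 - e" 0, where 'a = 'a] False by simp
    ultimately have "(l\<^sup>2 - e) *\<^sub>R (1 :: 'a bop) = 0" by simp
    with nz False show False by simp
  qed
qed

lemma real_spectrum_nonempty:
  fixes T :: "'a::chilbert bop"
  assumes "selfadjoint T" and "(1 :: 'a bop) \<noteq> 0"
  shows "real_spectrum T \<noteq> {}"
proof -
  let ?p = "[:(norm T)\<^sup>2, 0, -1:]"
  have "poly_op ?p T = (norm T)\<^sup>2 *\<^sub>R 1 - T * T"
    by (simp add: poly_op_pCons)
  then have "\<not> invertible_op (poly_op ?p T)"
    using norm_square_minus_square_not_invertible[OF assms] by simp
  moreover have "?p \<noteq> 0" by simp
  ultimately show ?thesis using invertible_poly_op[OF assms(1), of ?p] by blast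
qed

text \<open>
  With \<open>l = \<parallel>q(T)\<parallel>\<close>, the operator \<open>l\<^sup>2 - q(T)\<^sup>2\<close> is not invertible, so \<open>l\<^sup>2 - q\<^sup>2\<close> vanishes somewhere on the
  spectrum.  This bound by the spectrum itself, and not merely by an interval containing it, makes the limit in the
  definition of \<open>cfc\<close> unique.
\<close>

lemma norm_poly_op_le:
  fixes T :: "'a::chilbert bop"
  assumes T: "selfadjoint T" and c: "0 \<le> c" and q: "\<And>t. t \<in> real_spectrum T \<Longrightarrow> \<bar>poly q t\<bar> \<le> c"
  shows "norm (poly_op q T) \<le> c"
proof (rule ccontr)
  define S l where "S = poly_op q T" and "l = norm S"
  assume "\<not> ?thesis"
  then have lc: "c < l" by (simp add: l_def S_def)
  have sa: "selfadjoint S" unfolding S_def by (rule selfadjoint_poly_op[OF T])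
  have nz: "(1 :: 'a bop) \<noteq> 0"
  proof
    assume "(1 :: 'a bop) = 0"
    then have "S = 0" by (metis mult_1 mult_zero_left)
    with lc c show False by (simp add: l_def)
  qed
  define p where "p = [:l\<^sup>2:] - q * q"
  have root: "poly p t \<noteq> 0" if t: "t \<in> real_spectrum T" for t
  proof -
    have "\<bar>poly q t\<bar>\<^sup>2 < l\<^sup>2"
      using q[OF t] lc by (intro power_strict_mono) auto
    then show "poly p t \<noteq> 0" by (simp add: p_def power2_eq_square)
  qed
  have "invertible_op (poly_op p T)"
    using real_spectrum_nonempty[OF T nz] root by (intro invertible_poly_op T) auto
  moreover have "poly_op p T = l\<^sup>2 *\<^sub>R 1 - S * S"
    by (simp add: p_def poly_op_diff poly_op_mult S_def)
  ultimately show False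
    using norm_square_minus_square_not_invertible[OF sa nz] by (simp add: l_def)
qed

section \<open>Continuous functional calculus\<close>

lemma poly_op_uniform_tendsto_0:
  fixes T :: "'a::chilbert bop"
  assumes T: "selfadjoint T"
    and "uniform_limit (real_spectrum T) (\<lambda>n. poly (p n)) f sequentially"
    and "uniform_limit (real_spectrum T) (\<lambda>n. poly (q n)) f sequentially"
  shows "(\<lambda>n. poly_op (p n) T - poly_op (q n) T) \<longlonglongrightarrow> 0"
proof (rule tendstoI)
  fix e :: real assume e: "0 < e"
  have "\<forall>\<^sub>F n in sequentially. \<forall>t\<in>real_spectrum T. dist (poly (p n) t) (f t) < e/4"
    "\<forall>\<^sub>F n in sequentially. \<forall>t\<in>real_spectrum T. dist (poly (q n) t) (f t) < e/4"
    using e by (auto intro: uniform_limitD[OF assms(2)] uniform_limitD[OF assms(3)] simp del: divide_less_eq less_divide_eq less_divide_eq_numeral1)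
  then show "\<forall>\<^sub>F n in sequentially. dist (poly_op (p n) T - poly_op (q n) T) 0 < e"
  proof eventually_elim
    case (elim n)
    have "norm (poly_op (p n - q n) T) \<le> e/2"
    proof (rule norm_poly_op_le[OF T])
      fix t assume "t \<in> real_spectrum T"
      with elim have "dist (poly (p n) t) (f t) < e/4" "dist (poly (q n) t) (f t) < e/4" by auto
      then show "\<bar>poly (p n - q n) t\<bar> \<le> e/2" unfolding dist_real_def poly_diff by linarith
    qed (use e in simp)
    then show ?case using e by (simp add: poly_op_diff)
  qed
qed

lemma poly_op_uniform_convergent:
  fixes T :: "'a::chilbert bop"
  assumes T: "selfadjoint T"
    and lim: "uniform_limit (real_spectrum T) (\<lambda>n. poly (q n)) f sequentially"
  shows "convergent (\<lambda>n. poly_op (q n) T)"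
proof (rule Cauchy_convergent, rule metric_CauchyI)
  fix e :: real assume e: "0 < e"
  from uniform_limitD[OF lim, of "e/4"] e obtain N
    where N: "\<And>n t. n \<ge> N \<Longrightarrow> t \<in> real_spectrum T \<Longrightarrow> dist (poly (q n) t) (f t) < e/4"
    unfolding eventually_sequentially by auto
  show "\<exists>M. \<forall>m\<ge>M. \<forall>n\<ge>M. dist (poly_op (q m) T) (poly_op (q n) T) < e"
  proof (intro exI allI impI)
    fix m n assume mn: "m \<ge> N" "n \<ge> N"
    have "norm (poly_op (q m - q n) T) \<le> e/2"
    proof (rule norm_poly_op_le[OF T])
      fix t assume "t \<in> real_spectrum T"
      with N mn have "dist (poly (q m) t) (f t) < e/4" "dist (poly (q n) t) (f t) < e/4" by auto
      then show "\<bar>poly (q m - q n) t\<bar> \<le> e/2" unfolding dist_real_def poly_diff by linarith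
    qed (use e in simp)
    then show "dist (poly_op (q m) T) (poly_op (q n) T) < e"
      using e by (simp add: poly_op_diff dist_norm)
  qed
qed

lemma cfc_eqI:
  fixes T :: "'a::chilbert bop"
  assumes T: "selfadjoint T"
    and lim: "uniform_limit (real_spectrum T) (\<lambda>n. poly (q n)) f sequentially"
    and Y: "(\<lambda>n. poly_op (q n) T) \<longlonglongrightarrow> Y"
  shows "cfc f T = Y"
  unfolding cfc_def real_spectrum_def[symmetric]
proof (rule the_equality)
  fix Z
  assume "\<exists>p. uniform_limit (real_spectrum T) (\<lambda>n. poly (p n)) f sequentially \<and>
      (\<lambda>n. poly_op (p n) T) \<longlonglongrightarrow> Z"
  then obtain p where p: "uniform_limit (real_spectrum T) (\<lambda>n. poly (p n)) f sequentially"
    "(\<lambda>n. poly_op (p n) T) \<longlonglongrightarrow> Z" by blast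
  have "(\<lambda>n. poly_op (p n) T - poly_op (q n) T) \<longlonglongrightarrow> Z - Y"
    by (intro tendsto_diff p Y)
  then have "Z - Y = 0"
    by (rule LIMSEQ_unique[OF _ poly_op_uniform_tendsto_0[OF T p(1) lim]])
  then show "Z = Y" by simp
qed (use lim Y in blast)

lemma Weierstrass_poly_sequence:
  fixes f :: "real \<Rightarrow> real"
  assumes "continuous_on {a..b} f"
  obtains q :: "nat \<Rightarrow> real poly" where "uniform_limit {a..b} (\<lambda>n. poly (q n)) f sequentially"
proof -
  have "\<exists>q. \<forall>t\<in>{a..b}. \<bar>f t - poly q t\<bar> < inverse (real (Suc n))" for n
  proof -
    obtain g where g: "real_polynomial_function g" "\<And>x. x \<in> {a..b} \<Longrightarrow> \<bar>f x - g x\<bar> < inverse (real (Suc n))"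
      using Stone_Weierstrass_real_polynomial_function[OF compact_Icc assms, of "inverse (real (Suc n))"]
      by auto
    then obtain c N where "g = (\<lambda>x. \<Sum>i\<le>N. c i * x ^ i)"
      unfolding real_polynomial_function_iff_sum by blast
    then have "g = poly (\<Sum>i\<le>N. monom (c i) i)"
      by (simp add: fun_eq_iff poly_sum poly_monom)
    with g(2) show ?thesis by (intro exI[of _ "\<Sum>i\<le>N. monom (c i) i"]) (simp del: of_nat_Suc)
  qed
  then obtain q where q: "\<And>n t. t \<in> {a..b} \<Longrightarrow> \<bar>f t - poly (q n) t\<bar> < inverse (real (Suc n))"
    by metis
  have "uniform_limit {a..b} (\<lambda>n. poly (q n)) f sequentially"
  proof (rule uniform_limitI)
    fix e :: real assume "0 < e"
    then have "\<forall>\<^sub>F n in sequentially. inverse (real (Suc n)) < e"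
      using order_tendstoD(2)[OF LIMSEQ_inverse_real_of_nat] by auto
    then show "\<forall>\<^sub>F n in sequentially. \<forall>x\<in>{a..b}. dist (poly (q n) x) (f x) < e"
    proof eventually_elim
      case (elim n)
      then show ?case using q[of _ n] by (fastforce simp: dist_real_def abs_minus_commute)
    qed
  qed
  then show ?thesis by (rule that)
qed

lemma selfadjoint_limit:
  assumes "\<And>n. selfadjoint (X n)" "X \<longlonglongrightarrow> Y" shows "selfadjoint Y"
  unfolding selfadjoint_iff
proof (intro allI)
  fix x y
  note lim = bounded_linear.tendsto[OF bounded_linear_bop_apply assms(2)]
  have "(\<lambda>n. rinner (bop_apply (X n) x) y) \<longlonglongrightarrow> rinner (bop_apply Y x) y"
    by (intro rinner.tendsto lim tendsto_const)
  moreover have "(\<lambda>n. rinner (bop_apply (X n) x) y) \<longlonglongrightarrow> rinner x (bop_apply Y y)"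
    unfolding selfadjointD[OF assms(1)] by (intro rinner.tendsto lim tendsto_const)
  ultimately show "rinner (bop_apply Y x) y = rinner x (bop_apply Y y)"
    by (rule LIMSEQ_unique)
qed

text \<open>
  Functions are approximated uniformly on an interval that contains the spectrum, so that it is enough to
  know bounds of \<open>T\<close> in the order.
\<close>

context
  fixes T :: "'a::chilbert bop" and a b :: real
  assumes aT: "a *\<^sub>R 1 \<le> T" and Tb: "T \<le> b *\<^sub>R 1"
begin

lemma selfadjoint_of_bounds: "selfadjoint T"
  using aT by (rule selfadjoint_of_le)

lemma real_spectrum_bounds: "real_spectrum T \<subseteq> {a..b}"
proof
  fix t assume t: "t \<in> real_spectrum T"
  have "\<not> t < a"
  proof
    assume "t < a"
    moreover have "(a - t) *\<^sub>R 1 \<le> T - t *\<^sub>R 1" using aT by (simp add: scaleR_diff_left)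
    ultimately have "invertible_op ((-1) *\<^sub>R (T - t *\<^sub>R 1))"
      by (intro invertible_op_scaleR invertible_op_of_ge[of "a - t"]) auto
    with t show False by (simp add: real_spectrum_iff)
  qed
  moreover have "\<not> b < t"
  proof
    assume "b < t"
    moreover have "(t - b) *\<^sub>R 1 \<le> t *\<^sub>R 1 - T" using Tb by (simp add: scaleR_diff_left)
    ultimately have "invertible_op (t *\<^sub>R 1 - T)"
      by (intro invertible_op_of_ge[of "t - b"]) auto
    with t show False by (simp add: real_spectrum_iff)
  qed
  ultimately show "t \<in> {a..b}" by simp
qed

lemma poly_op_tendsto_cfc:
  assumes "uniform_limit {a..b} (\<lambda>n. poly (q n)) f sequentially"
  shows "(\<lambda>n. poly_op (q n) T) \<longlonglongrightarrow> cfc f T"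
proof -
  have lim: "uniform_limit (real_spectrum T) (\<lambda>n. poly (q n)) f sequentially"
    using assms real_spectrum_bounds by (rule uniform_limit_on_subset)
  from poly_op_uniform_convergent[OF selfadjoint_of_bounds this]
  obtain Y where Y: "(\<lambda>n. poly_op (q n) T) \<longlonglongrightarrow> Y" by (auto simp: convergent_def)
  with cfc_eqI[OF selfadjoint_of_bounds lim] show ?thesis by simp
qed

lemma cfc_eq_of_uniform_limit:
  assumes "uniform_limit {a..b} (\<lambda>n. poly (q n)) f sequentially" "(\<lambda>n. poly_op (q n) T) \<longlonglongrightarrow> Y"
  shows "cfc f T = Y"
  using assms poly_op_tendsto_cfc LIMSEQ_unique by blast

lemma cfc_poly: "cfc (poly q) T = poly_op q T"
  by (rule cfc_eq_of_uniform_limit[of "\<lambda>_. q"]) (auto intro: uniform_limitI)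

lemma cfc_const: "cfc (\<lambda>_. c) T = c *\<^sub>R 1"
proof -
  have "poly [:c:] = (\<lambda>_. c)" by auto
  with cfc_poly[of "[:c:]"] show ?thesis by simp
qed

lemma cfc_id: "cfc (\<lambda>t. t) T = T"
proof -
  have "poly [:0, 1:] = (\<lambda>t::real. t)" by auto
  with cfc_poly[of "[:0, 1:]"] show ?thesis by (simp add: poly_op_pCons)
qed

lemma cfc_cong: 
  assumes "\<And>t. t \<in> {a..b} \<Longrightarrow> f t = g t" shows "cfc f T = cfc g T"
proof -
  have "uniform_limit (real_spectrum T) h f sequentially \<longleftrightarrow> uniform_limit (real_spectrum T) h g sequentially"
    for h :: "nat \<Rightarrow> real \<Rightarrow> real"
    using assms real_spectrum_bounds by (intro uniform_limit_cong') auto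
  then show ?thesis by (simp add: cfc_def flip: real_spectrum_def)
qed

lemma cfc_add:
  assumes f: "continuous_on {a..b} f" and g: "continuous_on {a..b} g"
  shows "cfc (\<lambda>t. f t + g t) T = cfc f T + cfc g T"
proof -
  obtain p where p: "uniform_limit {a..b} (\<lambda>n. poly (p n)) f sequentially"
    using Weierstrass_poly_sequence[OF f] .
  obtain q where q: "uniform_limit {a..b} (\<lambda>n. poly (q n)) g sequentially"
    using Weierstrass_poly_sequence[OF g] .
  show ?thesis
  proof (rule cfc_eq_of_uniform_limit)
    show "uniform_limit {a..b} (\<lambda>n. poly (p n + q n)) (\<lambda>t. f t + g t) sequentially"
      unfolding poly_add by (rule uniform_limit_add[OF p q])
    show "(\<lambda>n. poly_op (p n + q n) T) \<longlonglongrightarrow> cfc f T + cfc g T"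
      unfolding poly_op_add by (intro tendsto_add poly_op_tendsto_cfc p q)
  qed
qed

lemma cfc_mult:
  assumes f: "continuous_on {a..b} f" and g: "continuous_on {a..b} g"
  shows "cfc (\<lambda>t. f t * g t) T = cfc f T * cfc g T"
proof -
  obtain p where p: "uniform_limit {a..b} (\<lambda>n. poly (p n)) f sequentially"
    using Weierstrass_poly_sequence[OF f] .
  obtain q where q: "uniform_limit {a..b} (\<lambda>n. poly (q n)) g sequentially"
    using Weierstrass_poly_sequence[OF g] .
  have bdd: "bounded (f ` {a..b})" "bounded (g ` {a..b})"
    using f g by (auto intro!: compact_imp_bounded compact_continuous_image)
  show ?thesis
  proof (rule cfc_eq_of_uniform_limit)
    show "uniform_limit {a..b} (\<lambda>n. poly (p n * q n)) (\<lambda>t. f t * g t) sequentially"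
      unfolding poly_mult by (rule uniform_lim_mult[OF p q bdd])
    show "(\<lambda>n. poly_op (p n * q n) T) \<longlonglongrightarrow> cfc f T * cfc g T"
      unfolding poly_op_mult by (intro tendsto_mult poly_op_tendsto_cfc p q)
  qed
qed

lemma cfc_scaleR:
  assumes f: "continuous_on {a..b} f" shows "cfc (\<lambda>t. c * f t) T = c *\<^sub>R cfc f T"
  using cfc_mult[OF continuous_on_const f, of c] by (simp add: cfc_const)

lemma cfc_diff:
  assumes f: "continuous_on {a..b} f" and g: "continuous_on {a..b} g"
  shows "cfc (\<lambda>t. f t - g t) T = cfc f T - cfc g T"
proof -
  have "continuous_on {a..b} (\<lambda>t. (-1) * g t)" using g by (intro continuous_intros)
  from cfc_add[OF f this] cfc_scaleR[OF g, of "-1"] show ?thesis by simp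
qed

lemma cfc_sum:
  assumes "finite I" "\<And>i. i \<in> I \<Longrightarrow> continuous_on {a..b} (f i)"
  shows "cfc (\<lambda>t. \<Sum>i\<in>I. f i t) T = (\<Sum>i\<in>I. cfc (f i) T)"
  using assms
proof (induction I rule: finite_induct)
  case empty
  then show ?case using cfc_const[of 0] by simp
next
  case (insert i I)
  have "continuous_on {a..b} (\<lambda>t. \<Sum>i\<in>I. f i t)"
    using insert by (intro continuous_on_sum) auto
  then show ?case using insert by (simp add: cfc_add)
qed

lemma selfadjoint_cfc:
  assumes f: "continuous_on {a..b} f" shows "selfadjoint (cfc f T)"
proof -
  obtain p where p: "uniform_limit {a..b} (\<lambda>n. poly (p n)) f sequentially"
    using Weierstrass_poly_sequence[OF f] .
  show ?thesis
    by (rule selfadjoint_limit[OF _ poly_op_tendsto_cfc[OF p]])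
      (rule selfadjoint_poly_op[OF selfadjoint_of_bounds])
qed

lemma cfc_nonneg:
  assumes f: "continuous_on {a..b} f" and ge: "\<And>t. t \<in> {a..b} \<Longrightarrow> 0 \<le> f t"
  shows "0 \<le> cfc f T"
proof -
  have c: "continuous_on {a..b} (\<lambda>t. sqrt (f t))" using f by (intro continuous_intros)
  have "cfc f T = cfc (\<lambda>t. sqrt (f t) * sqrt (f t)) T"
    using ge by (intro cfc_cong) simp
  also have "\<dots> = cfc (\<lambda>t. sqrt (f t)) T * cfc (\<lambda>t. sqrt (f t)) T"
    by (rule cfc_mult[OF c c])
  finally show ?thesis using square_nonneg[OF selfadjoint_cfc[OF c]] by simp
qed

lemma cfc_mono:
  assumes f: "continuous_on {a..b} f" and g: "continuous_on {a..b} g"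
    and le: "\<And>t. t \<in> {a..b} \<Longrightarrow> f t \<le> g t"
  shows "cfc f T \<le> cfc g T"
proof -
  have "0 \<le> cfc (\<lambda>t. g t - f t) T"
    using le by (intro cfc_nonneg continuous_intros f g) auto
  then show ?thesis by (simp add: cfc_diff[OF g f])
qed

lemma norm_cfc_le:
  assumes f: "continuous_on {a..b} f" and le: "\<And>t. t \<in> {a..b} \<Longrightarrow> \<bar>f t\<bar> \<le> e" and e: "0 \<le> e"
  shows "norm (cfc f T) \<le> e"
proof (rule norm_le_of_between[OF _ _ e])
  have "cfc (\<lambda>_. - e) T \<le> cfc f T" "cfc f T \<le> cfc (\<lambda>_. e) T"
    by (intro cfc_mono f continuous_on_const; use le in force)+
  then show "- (e *\<^sub>R 1) \<le> cfc f T" "cfc f T \<le> e *\<^sub>R 1" by (simp_all add: cfc_const)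
qed

lemma cfc_bounds:
  assumes f: "continuous_on {a..b} f" and r: "\<And>t. t \<in> {a..b} \<Longrightarrow> f t \<in> {c..d}"
  shows "c *\<^sub>R 1 \<le> cfc f T" "cfc f T \<le> d *\<^sub>R 1"
proof -
  have "cfc (\<lambda>_. c) T \<le> cfc f T" "cfc f T \<le> cfc (\<lambda>_. d) T"
    by (intro cfc_mono f continuous_on_const; use r in force)+
  then show "c *\<^sub>R 1 \<le> cfc f T" "cfc f T \<le> d *\<^sub>R 1" by (simp_all add: cfc_const)
qed

lemma poly_op_cfc:
  assumes f: "continuous_on {a..b} f"
  shows "poly_op q (cfc f T) = cfc (\<lambda>t. poly q (f t)) T"
proof (induction q)
  case 0
  show ?case using cfc_const[of 0] by simp
next
  case (pCons c q)
  have "cfc (\<lambda>t. c + f t * poly q (f t)) T = cfc (\<lambda>_. c) T + cfc f T * cfc (\<lambda>t. poly q (f t)) T"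
    using f by (simp add: cfc_add cfc_mult continuous_intros)
  then show ?case using pCons by (simp add: poly_op_pCons cfc_const)
qed

end

text \<open>
  For polynomial \<open>g\<close> this is multiplicativity; the general case follows by approximating \<open>g\<close> uniformly on an
  interval that contains the values of \<open>f\<close>.
\<close>

lemma cfc_compose:
  fixes T :: "'a::chilbert bop"
  assumes T: "a *\<^sub>R 1 \<le> T" "T \<le> b *\<^sub>R 1"
    and f: "continuous_on {a..b} f" and r: "\<And>t. t \<in> {a..b} \<Longrightarrow> f t \<in> {c..d}"
    and g: "continuous_on {c..d} g"
  shows "cfc g (cfc f T) = cfc (\<lambda>t. g (f t)) T"
proof -
  note b = cfc_bounds[OF T f r]
  have gf: "continuous_on {a..b} (\<lambda>t. g (f t))"
    using r by (intro continuous_on_compose2[OF g f]) auto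
  obtain p where p: "uniform_limit {c..d} (\<lambda>n. poly (p n)) g sequentially"
    using Weierstrass_poly_sequence[OF g] .
  have pf: "continuous_on {a..b} (\<lambda>t. poly (p n) (f t))" for n
    using f by (intro continuous_intros)
  have "(\<lambda>n. cfc (\<lambda>t. poly (p n) (f t)) T) \<longlonglongrightarrow> cfc (\<lambda>t. g (f t)) T"
  proof (rule tendstoI)
    fix e :: real assume e: "0 < e"
    then have "\<forall>\<^sub>F n in sequentially. \<forall>x\<in>{c..d}. dist (poly (p n) x) (g x) < e/2"
      using uniform_limitD[OF p, of "e/2"] by simp
    then show "\<forall>\<^sub>F n in sequentially. dist (cfc (\<lambda>t. poly (p n) (f t)) T) (cfc (\<lambda>t. g (f t)) T) < e"
    proof eventually_elim
      case (elim n)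
      have "norm (cfc (\<lambda>t. poly (p n) (f t) - g (f t)) T) \<le> e/2"
        using elim r e by (intro norm_cfc_le[OF T] continuous_intros pf gf)
          (auto simp: dist_real_def intro: less_imp_le)
      then show ?case using e by (simp add: dist_norm cfc_diff[OF T pf gf])
    qed
  qed
  moreover have "(\<lambda>n. poly_op (p n) (cfc f T)) \<longlonglongrightarrow> cfc g (cfc f T)"
    using r by (intro poly_op_tendsto_cfc[OF b] p) auto
  ultimately show ?thesis
    unfolding poly_op_cfc[OF T f] by (metis LIMSEQ_unique)
qed

section \<open>Real powers of strictly positive operators\<close>

text \<open>
  For a self-adjoint operator this is the same as being positive and invertible, but a lower bound is what
  the functional calculus of real powers needs, and it passes upwards in the order.
\<close>

definition strictly_positive :: "'a::complex_inner bop \<Rightarrow> bool"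
  where "strictly_positive X \<longleftrightarrow> (\<exists>c>0. c *\<^sub>R 1 \<le> X)"

lemma strictly_positiveI: "0 < c \<Longrightarrow> c *\<^sub>R 1 \<le> X \<Longrightarrow> strictly_positive X"
  by (auto simp: strictly_positive_def)

lemma strictly_positive_mono: "strictly_positive X \<Longrightarrow> X \<le> Y \<Longrightarrow> strictly_positive Y"
  by (auto simp: strictly_positive_def intro: order_trans)

lemma selfadjoint_strictly_positive: "strictly_positive X \<Longrightarrow> selfadjoint X"
  by (auto simp: strictly_positive_def intro: selfadjoint_of_le)

lemma strictly_positive_nonneg: 
  assumes "strictly_positive (X :: 'a::complex_inner bop)" shows "0 \<le> X"
proof -
  obtain c where c: "0 < c" "c *\<^sub>R 1 \<le> X" using assms by (auto simp: strictly_positive_def)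
  have "0 *\<^sub>R 1 \<le> c *\<^sub>R (1 :: 'a bop)" using c by (intro scaleR_one_mono) simp
  with c show ?thesis by simp
qed

lemma strictly_positive_scaleR:
  assumes "0 < c" "strictly_positive X" shows "strictly_positive (c *\<^sub>R X)"
proof -
  obtain d where d: "0 < d" "d *\<^sub>R 1 \<le> X" using assms by (auto simp: strictly_positive_def)
  show ?thesis
    using scaleR_left_mono[OF d(2), of c] assms d by (intro strictly_positiveI[of "c * d"]) auto
qed

lemma strictly_positive_bounds:
  assumes "strictly_positive X"
  obtains a b where "0 < a" "a < b" "a *\<^sub>R 1 \<le> X" "X \<le> b *\<^sub>R (1 :: 'a::complex_inner bop)"
proof -
  obtain c where c: "0 < c" "c *\<^sub>R 1 \<le> X" using assms by (auto simp: strictly_positive_def)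
  have "X \<le> norm X *\<^sub>R 1" by (rule selfadjoint_le_norm[OF selfadjoint_strictly_positive[OF assms]])
  also have "\<dots> \<le> (norm X + 2 * c) *\<^sub>R 1" using c by (intro scaleR_one_mono) simp
  finally show ?thesis using c norm_ge_zero[of X] by (intro that[of c "norm X + 2 * c"]) linarith+
qed

lemma continuous_on_powr_interval: "0 < a \<Longrightarrow> continuous_on {a..b} (\<lambda>t::real. t powr x)"
  by (intro continuous_intros) auto

lemma powr_op_add:
  assumes "strictly_positive (X :: 'a::chilbert bop)"
  shows "X powr\<^sub>o (x + y) = X powr\<^sub>o x * X powr\<^sub>o y"
proof -
  obtain a b where ab: "0 < a" "a < b" "a *\<^sub>R 1 \<le> X" "X \<le> b *\<^sub>R 1"
    using strictly_positive_bounds[OF assms] .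
  show ?thesis
    unfolding powr_op_def powr_add by (intro cfc_mult[OF ab(3,4)] continuous_on_powr_interval ab)
qed

lemma powr_op_zero:
  assumes "strictly_positive (X :: 'a::chilbert bop)" shows "X powr\<^sub>o 0 = 1"
proof -
  obtain a b where ab: "0 < a" "a < b" "a *\<^sub>R 1 \<le> X" "X \<le> b *\<^sub>R 1"
    using strictly_positive_bounds[OF assms] .
  have "X powr\<^sub>o 0 = cfc (\<lambda>_. 1) X"
    unfolding powr_op_def using ab by (intro cfc_cong[OF ab(3,4)]) auto
  then show ?thesis by (simp add: cfc_const[OF ab(3,4)])
qed

lemma powr_op_one:
  assumes "strictly_positive (X :: 'a::chilbert bop)" shows "X powr\<^sub>o 1 = X"
proof -
  obtain a b where ab: "0 < a" "a < b" "a *\<^sub>R 1 \<le> X" "X \<le> b *\<^sub>R 1"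
    using strictly_positive_bounds[OF assms] .
  have "X powr\<^sub>o 1 = cfc (\<lambda>t. t) X"
    unfolding powr_op_def using ab by (intro cfc_cong[OF ab(3,4)]) auto
  then show ?thesis by (simp add: cfc_id[OF ab(3,4)])
qed

lemma powr_op_minus_cancel:
  assumes "strictly_positive (X :: 'a::chilbert bop)"
  shows "X powr\<^sub>o (- x) * X powr\<^sub>o x = 1" "X powr\<^sub>o x * X powr\<^sub>o (- x) = 1"
  using powr_op_add[OF assms, of "-x" x] powr_op_add[OF assms, of x "-x"] powr_op_zero[OF assms] by simp_all

lemma inv_op_eq_powr_op:
  assumes "strictly_positive (X :: 'a::chilbert bop)" shows "inv_op X = X powr\<^sub>o (-1)"
  using powr_op_minus_cancel[OF assms, of 1] powr_op_one[OF assms] by (intro inv_op_eqI) auto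

lemma selfadjoint_powr_op:
  assumes "strictly_positive (X :: 'a::chilbert bop)" shows "selfadjoint (X powr\<^sub>o x)"
proof -
  obtain a b where ab: "0 < a" "a < b" "a *\<^sub>R 1 \<le> X" "X \<le> b *\<^sub>R 1"
    using strictly_positive_bounds[OF assms] .
  then show ?thesis
    unfolding powr_op_def by (intro selfadjoint_cfc[OF ab(3,4)] continuous_on_powr_interval)
qed

lemma strictly_positive_of_invertible:
  "0 \<le> X \<Longrightarrow> X * Y = 1 \<Longrightarrow> Y * X = 1 \<Longrightarrow> strictly_positive X"
  unfolding strictly_positive_def by (rule invertible_nonneg_ge) (auto simp: invertible_op_def)

lemma strictly_positive_powr_op:
  assumes "strictly_positive (X :: 'a::chilbert bop)" shows "strictly_positive (X powr\<^sub>o x)"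
proof (rule strictly_positive_of_invertible)
  show "0 \<le> X powr\<^sub>o x"
    using square_nonneg[OF selfadjoint_powr_op[OF assms, of "x/2"]] powr_op_add[OF assms, of "x/2" "x/2"]
    by simp
qed (rule powr_op_minus_cancel[OF assms])+

lemma strictly_positive_inv_op:
  "strictly_positive (X :: 'a::chilbert bop) \<Longrightarrow> strictly_positive (inv_op X)"
  by (simp add: inv_op_eq_powr_op strictly_positive_powr_op)

lemma inv_op_cancel:
  assumes "strictly_positive (X :: 'a::chilbert bop)"
  shows "X * inv_op X = 1" "inv_op X * X = 1"
  using powr_op_minus_cancel[OF assms, of 1] powr_op_one[OF assms] by (simp_all add: inv_op_eq_powr_op assms)

lemma powr_op_powr_op:
  assumes "strictly_positive (X :: 'a::chilbert bop)"
  shows "(X powr\<^sub>o x) powr\<^sub>o y = X powr\<^sub>o (x * y)"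
proof -
  obtain a b where ab: "0 < a" "a < b" "a *\<^sub>R 1 \<le> X" "X \<le> b *\<^sub>R 1"
    using strictly_positive_bounds[OF assms] .
  define c d where "c = min (a powr x) (b powr x)" and "d = max (a powr x) (b powr x)"
  have c: "c > 0" using ab by (auto simp: c_def)
  have r: "t powr x \<in> {c..d}" if "t \<in> {a..b}" for t
  proof (cases "x \<ge> 0")
    case True
    then have "a powr x \<le> t powr x" "t powr x \<le> b powr x"
      using that ab by (auto intro: powr_mono2)
    then show ?thesis by (auto simp: c_def d_def)
  next
    case False
    then have "b powr x \<le> t powr x" "t powr x \<le> a powr x"
      using that ab by (auto intro!: powr_mono2')
    then show ?thesis by (auto simp: c_def d_def)
  qed
  have "(X powr\<^sub>o x) powr\<^sub>o y = cfc (\<lambda>t. (t powr x) powr y) X"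
    unfolding powr_op_def
    by (rule cfc_compose[OF ab(3,4) continuous_on_powr_interval[OF ab(1)] r continuous_on_powr_interval[OF c]])
  then show ?thesis by (simp add: powr_op_def powr_powr)
qed

lemma powr_op_scaleR:
  assumes "strictly_positive (X :: 'a::chilbert bop)" "0 < c"
  shows "(c *\<^sub>R X) powr\<^sub>o x = (c powr x) *\<^sub>R X powr\<^sub>o x"
proof -
  obtain a b where ab: "0 < a" "a < b" "a *\<^sub>R 1 \<le> X" "X \<le> b *\<^sub>R 1"
    using strictly_positive_bounds[OF assms(1)] .
  have ca: "0 < c * a" using assms ab by simp
  have "(c *\<^sub>R X) powr\<^sub>o x = cfc (\<lambda>t. t powr x) (cfc (\<lambda>t. c * t) X)"
    using cfc_scaleR[OF ab(3,4) continuous_on_id, of c] by (simp add: powr_op_def cfc_id[OF ab(3,4)])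
  also have "\<dots> = cfc (\<lambda>t. (c * t) powr x) X"
    using assms ab
    by (intro cfc_compose[OF ab(3,4) _ _ continuous_on_powr_interval[OF ca], where d = "c * b"] continuous_intros)
      auto
  also have "\<dots> = cfc (\<lambda>t. c powr x * t powr x) X"
    using assms ab by (intro cfc_cong[OF ab(3,4)]) (auto simp: powr_mult)
  also have "\<dots> = (c powr x) *\<^sub>R X powr\<^sub>o x"
    unfolding powr_op_def by (intro cfc_scaleR[OF ab(3,4)] continuous_on_powr_interval ab)
  finally show ?thesis .
qed

lemma powr_op_le_self:
  assumes "strictly_positive (X :: 'a::chilbert bop)" "X \<le> 1" "1 \<le> s"
  shows "X powr\<^sub>o s \<le> X"
proof -
  obtain c where c: "0 < c" "c *\<^sub>R 1 \<le> X" using assms by (auto simp: strictly_positive_def)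
  have X1: "X \<le> 1 *\<^sub>R 1" using assms by simp
  have "cfc (\<lambda>t. t powr s) X \<le> cfc (\<lambda>t. t) X"
  proof (intro cfc_mono[OF c(2) X1] continuous_on_powr_interval c continuous_on_id)
    fix t assume "t \<in> {c..1}"
    then show "t powr s \<le> t" using c assms(3) powr_mono_both[of 1 s t t] powr_mono'[of 1 s t] by auto
  qed
  then show ?thesis by (simp add: powr_op_def cfc_id[OF c(2) X1])
qed

text \<open>
  The function \<open>t powr y\<close> is uniformly continuous in both arguments on a compact rectangle around the
  spectrum and \<open>x\<close>.  Stating continuity through the order makes it usable under positive maps.
\<close>

lemma powr_op_exponent_continuous:
  assumes X: "strictly_positive (X :: 'a::chilbert bop)" and e: "0 < e"
  obtains d where "0 < d"
    "\<And>y. \<bar>y - x\<bar> < d \<Longrightarrow> X powr\<^sub>o y \<le> X powr\<^sub>o x + e *\<^sub>R 1 \<and> X powr\<^sub>o x \<le> X powr\<^sub>o y + e *\<^sub>R 1"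
proof -
  obtain a b where ab: "0 < a" "a < b" "a *\<^sub>R 1 \<le> X" "X \<le> b *\<^sub>R 1"
    using strictly_positive_bounds[OF X] .
  let ?K = "{a..b} \<times> {x - 1..x + 1}"
  have "uniformly_continuous_on ?K (\<lambda>(t, y). t powr y)"
  proof (rule compact_uniformly_continuous)
    show "continuous_on ?K (\<lambda>(t, y). t powr y)"
      unfolding case_prod_beta using ab by (intro continuous_intros) auto
  qed (intro compact_Times compact_Icc)
  then obtain d where d: "d > 0" "\<And>u v. u \<in> ?K \<Longrightarrow> v \<in> ?K \<Longrightarrow> dist v u < d \<Longrightarrow>
      dist ((\<lambda>(t, y). t powr y) v) ((\<lambda>(t, y). t powr y) u) < e"
    using e unfolding uniformly_continuous_on_def by metis
  show ?thesis
  proof (rule that[of "min d 1"])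
    show "0 < min d 1" using d by simp
    fix y assume y: "\<bar>y - x\<bar> < min d 1"
    have "\<bar>y - x\<bar> < 1" using y by simp
    then have yb: "x - 1 \<le> y" "y \<le> x + 1" by linarith+
    have close: "\<bar>t powr y - t powr x\<bar> < e" if "t \<in> {a..b}" for t
      using d(2)[of "(t, x)" "(t, y)"] that y yb by (auto simp: dist_Pair_Pair dist_real_def)
    have *: "cfc (\<lambda>t. t powr u) X \<le> cfc (\<lambda>t. t powr v) X + e *\<^sub>R 1"
      if "\<And>t. t \<in> {a..b} \<Longrightarrow> t powr u \<le> t powr v + e" for u v
    proof -
      have "cfc (\<lambda>t. t powr u) X \<le> cfc (\<lambda>t. t powr v + e) X"
        by (intro cfc_mono[OF ab(3,4)] continuous_on_add continuous_on_const continuous_on_powr_interval ab that)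
      also have "\<dots> = cfc (\<lambda>t. t powr v) X + e *\<^sub>R 1"
        by (subst cfc_add[OF ab(3,4)])
          (auto intro: continuous_on_powr_interval ab simp: cfc_const[OF ab(3,4)])
      finally show ?thesis .
    qed
    show "X powr\<^sub>o y \<le> X powr\<^sub>o x + e *\<^sub>R 1 \<and> X powr\<^sub>o x \<le> X powr\<^sub>o y + e *\<^sub>R 1"
      unfolding powr_op_def
    proof (intro conjI *)
      fix t assume "t \<in> {a..b}"
      from close[OF this] show "t powr y \<le> t powr x + e" "t powr x \<le> t powr y + e" by auto
    qed
  qed
qed

lemma strictly_positive_sandwich:
  assumes X: "strictly_positive (X :: 'a::chilbert bop)" and Y: "strictly_positive Y"
  shows "strictly_positive (X powr\<^sub>o x * Y * X powr\<^sub>o x)"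
proof (rule strictly_positive_of_invertible[of _ "X powr\<^sub>o (-x) * inv_op Y * X powr\<^sub>o (-x)"])
  note sa = selfadjoint_powr_op[OF X]
  show "0 \<le> X powr\<^sub>o x * Y * X powr\<^sub>o x"
    using sandwich_mono[OF sa strictly_positive_nonneg[OF Y]] by simp
  have c: "X powr\<^sub>o x * (X powr\<^sub>o (-x) * Z) = Z" "X powr\<^sub>o (-x) * (X powr\<^sub>o x * Z) = Z"
    "Y * (inv_op Y * Z) = Z" "inv_op Y * (Y * Z) = Z" for Z
    by (simp_all add: powr_op_minus_cancel[OF X] inv_op_cancel[OF Y] flip: mult.assoc)
  show "X powr\<^sub>o x * Y * X powr\<^sub>o x * (X powr\<^sub>o (-x) * inv_op Y * X powr\<^sub>o (-x)) = 1"
    "X powr\<^sub>o (-x) * inv_op Y * X powr\<^sub>o (-x) * (X powr\<^sub>o x * Y * X powr\<^sub>o x) = 1"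
    by (simp_all add: mult.assoc c powr_op_minus_cancel[OF X])
qed

section \<open>Positive unital maps and powers\<close>

definition unital_positive :: "('a::complex_inner bop \<Rightarrow> 'b::complex_inner bop) \<Rightarrow> bool"
  where "unital_positive \<Phi> \<longleftrightarrow> linear \<Phi> \<and> positive_map \<Phi> \<and> \<Phi> 1 = 1"

lemma unital_positive_id: "unital_positive (\<lambda>X. X)"
  by (simp add: unital_positive_def positive_map_def linear_iff)

context
  fixes \<Phi> :: "'a::complex_inner bop \<Rightarrow> 'b::complex_inner bop"
  assumes \<Phi>: "unital_positive \<Phi>"
begin

lemma unital_positive_simps:
  "\<Phi> (X + Y) = \<Phi> X + \<Phi> Y" "\<Phi> (X - Y) = \<Phi> X - \<Phi> Y" "\<Phi> (- X) = - \<Phi> X"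
  "\<Phi> (c *\<^sub>R X) = c *\<^sub>R \<Phi> X" "\<Phi> 1 = 1" "\<Phi> (sum f I) = (\<Sum>i\<in>I. \<Phi> (f i))"
  using \<Phi> unfolding unital_positive_def
  by (auto simp: linear_add linear_diff linear_neg linear_scale linear_sum)

lemma unital_positive_nonneg: "0 \<le> X \<Longrightarrow> 0 \<le> \<Phi> X"
  using \<Phi> by (simp add: unital_positive_def positive_map_def)

lemma unital_positive_mono: "X \<le> Y \<Longrightarrow> \<Phi> X \<le> \<Phi> Y"
  using unital_positive_nonneg[of "Y - X"] by (simp add: unital_positive_simps)

lemma norm_unital_positive_le:
  assumes "selfadjoint X" shows "norm (\<Phi> X) \<le> norm X"
  using unital_positive_mono[OF between_norm(1)[OF assms]] unital_positive_mono[OF between_norm(2)[OF assms]]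
  by (intro norm_le_of_between) (simp_all add: unital_positive_simps)

lemma strictly_positive_unital_positive: "strictly_positive X \<Longrightarrow> strictly_positive (\<Phi> X)"
  unfolding strictly_positive_def using unital_positive_mono[of "_ *\<^sub>R 1" X]
  by (auto simp: unital_positive_simps)

end

lemma Bernstein_approx_interval:
  fixes h :: "real \<Rightarrow> real"
  assumes "a < b" "continuous_on {a..b} h" "0 < e"
  shows "\<exists>N. \<forall>n\<ge>N. \<forall>t\<in>{a..b}.
    \<bar>h t - (\<Sum>k\<le>n. h (a + (b - a) * (k / n)) * Bernstein n k ((t - a) / (b - a)))\<bar> < e"
proof -
  have "continuous_on {0..1} (\<lambda>s. h (a + (b - a) * s))"
  proof (rule continuous_on_compose2[OF assms(2)])
    have "a \<le> a + (b - a) * s \<and> a + (b - a) * s \<le> b" if "0 \<le> s" "s \<le> 1" for s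
    proof -
      have "0 \<le> (b - a) * s" "(b - a) * s \<le> (b - a) * 1"
        using that assms(1) by (intro mult_nonneg_nonneg mult_left_mono; simp)+
      note * = this
      show ?thesis using * by (simp add: algebra_simps)
    qed
    then show "(\<lambda>s. a + (b - a) * s) ` {0..1} \<subseteq> {a..b}" by auto
  qed (intro continuous_intros)
  from Bernstein_Weierstrass[OF this assms(3)] obtain N where
    N: "\<And>n s. n \<ge> N \<Longrightarrow> s \<in> {0..1} \<Longrightarrow>
      \<bar>h (a + (b - a) * s) - (\<Sum>k\<le>n. h (a + (b - a) * (k / n)) * Bernstein n k s)\<bar> < e" by blast
  show ?thesis
  proof (intro exI allI impI ballI)
    fix n t assume n: "n \<ge> N" and t: "t \<in> {a..b}"
    have "a + (b - a) * ((t - a) / (b - a)) = t" using assms(1) by simp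
    with N[OF n, of "(t - a) / (b - a)"] t assms(1)
    show "\<bar>h t - (\<Sum>k\<le>n. h (a + (b - a) * (k / n)) * Bernstein n k ((t - a) / (b - a)))\<bar> < e"
      by simp
  qed
qed

text \<open>
  This says that the block operator with diagonal \<open>\<Phi>(f\<^sup>2(T))\<close>, \<open>\<Phi>(g\<^sup>2(T))\<close> and off-diagonal \<open>\<Phi>(f g(T))\<close> is
  positive: on the commutative algebra generated by \<open>T\<close> a positive map is 2-positive.  The Bernstein polynomials
  \<open>B\<^sub>k\<close> of \<open>T\<close> form a partition of unity into positive operators, and with the positive operators
  \<open>H\<^sub>k = \<Phi>(B\<^sub>k(T))\<close> the form is, up to a uniform error, the sum over \<open>k\<close> of the form of \<open>H\<^sub>k\<close> at
  \<open>f(t\<^sub>k) x + g(t\<^sub>k) y\<close>.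
\<close>

lemma positive_map_block_nonneg:
  fixes \<Phi> :: "'a::chilbert bop \<Rightarrow> 'b::complex_inner bop"
  assumes \<Phi>: "unital_positive \<Phi>"
    and T: "a *\<^sub>R 1 \<le> T" "T \<le> b *\<^sub>R 1" and ab: "a < b"
    and f: "continuous_on {a..b} f" and g: "continuous_on {a..b} g"
  shows "0 \<le> rinner (bop_apply (\<Phi> (cfc (\<lambda>t. f t * f t) T)) x) x
      + 2 * rinner (bop_apply (\<Phi> (cfc (\<lambda>t. f t * g t) T)) x) y
      + rinner (bop_apply (\<Phi> (cfc (\<lambda>t. g t * g t) T)) y) y"
proof -
  define D where "D h x y = rinner (bop_apply (\<Phi> (cfc h T)) x) y" for h x y
  have approx: "\<exists>N. \<forall>n\<ge>N. \<forall>x y. \<bar>D h x y - (\<Sum>k\<le>n. h (a + (b - a) * (k / n)) *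
      D (\<lambda>t. Bernstein n k ((t - a) / (b - a))) x y)\<bar> \<le> e * (norm x * norm y)"
    if h: "continuous_on {a..b} h" and e: "0 < e" for h e
  proof -
    obtain N where N: "\<And>n t. n \<ge> N \<Longrightarrow> t \<in> {a..b} \<Longrightarrow>
      \<bar>h t - (\<Sum>k\<le>n. h (a + (b - a) * (k / n)) * Bernstein n k ((t - a) / (b - a)))\<bar> < e"
      using Bernstein_approx_interval[OF ab h e] by blast
    show ?thesis
    proof (intro exI allI impI)
      fix n x y assume n: "n \<ge> N"
      let ?B = "\<lambda>k t. Bernstein n k ((t - a) / (b - a))"
      let ?h = "\<lambda>k. h (a + (b - a) * (real k / real n))"
      have cB: "continuous_on {a..b} (?B k)" for k
        unfolding Bernstein_def using ab by (intro continuous_intros) auto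
      have chB: "continuous_on {a..b} (\<lambda>t. ?h k * ?B k t)" for k
        by (intro continuous_intros cB)
      have cS: "continuous_on {a..b} (\<lambda>t. \<Sum>k\<le>n. ?h k * ?B k t)"
        by (intro continuous_on_sum chB)
      define R where "R = cfc (\<lambda>t. h t - (\<Sum>k\<le>n. ?h k * ?B k t)) T"
      have "norm R \<le> e"
        unfolding R_def using N[OF n] e
        by (intro norm_cfc_le[OF T] continuous_on_diff h cS) (auto intro: less_imp_le)
      moreover have "selfadjoint R"
        unfolding R_def by (intro selfadjoint_cfc[OF T] continuous_on_diff h cS)
      ultimately have nR: "norm (\<Phi> R) \<le> e" using norm_unital_positive_le[OF \<Phi>] order_trans by blast
      have "R = cfc h T - (\<Sum>k\<le>n. ?h k *\<^sub>R cfc (?B k) T)"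
      proof -
        have "cfc (\<lambda>t. \<Sum>k\<le>n. ?h k * ?B k t) T = (\<Sum>k\<le>n. cfc (\<lambda>t. ?h k * ?B k t) T)"
          by (rule cfc_sum[OF T finite_atMost chB])
        also have "\<dots> = (\<Sum>k\<le>n. ?h k *\<^sub>R cfc (?B k) T)"
          by (intro sum.cong refl cfc_scaleR[OF T cB])
        finally show ?thesis unfolding R_def cfc_diff[OF T h cS] by (rule arg_cong)
      qed
      then have "rinner (bop_apply (\<Phi> R) x) y = D h x y - (\<Sum>k\<le>n. ?h k * D (?B k) x y)"
        by (simp add: D_def unital_positive_simps[OF \<Phi>] bop_simps rinner.diff_left
            linear_sum[OF bounded_linear.linear[OF bounded_linear_bop_apply]] rinner.sum_left
            rinner.scaleR_left)
      moreover have "\<bar>rinner (bop_apply (\<Phi> R) x) y\<bar> \<le> e * (norm x * norm y)"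
      proof -
        have "norm (bop_apply (\<Phi> R) x) \<le> e * norm x"
          using norm_bop_apply[of "\<Phi> R" x] mult_right_mono[OF nR norm_ge_zero[of x]] by linarith
        then have "norm (bop_apply (\<Phi> R) x) * norm y \<le> e * norm x * norm y"
          by (intro mult_right_mono) auto
        moreover have "\<bar>rinner u y\<bar> \<le> norm u * norm y" for u :: 'b
          using Cauchy_Schwarz_rinner[of u y] Cauchy_Schwarz_rinner[of "-u" y] by (simp add: rinner.minus_left)
        ultimately show ?thesis by (smt (verit) mult.assoc)
      qed
      ultimately show "\<bar>D h x y - (\<Sum>k\<le>n. ?h k * D (?B k) x y)\<bar> \<le> e * (norm x * norm y)" by simp
    qed
  qed
  have "0 \<le> D (\<lambda>t. f t * f t) x x + 2 * D (\<lambda>t. f t * g t) x y + D (\<lambda>t. g t * g t) y y"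
  proof (rule field_le_epsilon)
    fix e' :: real assume e': "0 < e'"
    \<comment> \<open>The three approximations together cost at most \<open>e (\<parallel>x\<parallel> + \<parallel>y\<parallel>)\<^sup>2\<close>.\<close>
    define e where "e = e' / ((norm x + norm y)\<^sup>2 + 1)"
    have pos: "(norm x + norm y)\<^sup>2 + 1 > 0" by (simp add: add_nonneg_pos)
    have e: "0 < e" using e' pos by (simp add: e_def)
    have "e * ((norm x + norm y)\<^sup>2 + 1) = e'" using pos by (simp add: e_def)
    then have ee': "e * (norm x + norm y)\<^sup>2 \<le> e'" using e by (simp add: distrib_left)
    have c: "continuous_on {a..b} (\<lambda>t. f t * f t)" "continuous_on {a..b} (\<lambda>t. f t * g t)"
      "continuous_on {a..b} (\<lambda>t. g t * g t)" by (intro continuous_intros f g)+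
    obtain N1 where N1: "\<forall>n\<ge>N1. \<forall>x y. \<bar>D (\<lambda>t. f t * f t) x y
        - (\<Sum>k\<le>n. (f (a + (b - a) * (k / n)) * f (a + (b - a) * (k / n)))
          * D (\<lambda>t. Bernstein n k ((t - a) / (b - a))) x y)\<bar> \<le> e * (norm x * norm y)"
      using approx[OF c(1) e] by (elim exE)
    obtain N2 where N2: "\<forall>n\<ge>N2. \<forall>x y. \<bar>D (\<lambda>t. f t * g t) x y
        - (\<Sum>k\<le>n. (f (a + (b - a) * (k / n)) * g (a + (b - a) * (k / n)))
          * D (\<lambda>t. Bernstein n k ((t - a) / (b - a))) x y)\<bar> \<le> e * (norm x * norm y)"
      using approx[OF c(2) e] by (elim exE)
    obtain N3 where N3: "\<forall>n\<ge>N3. \<forall>x y. \<bar>D (\<lambda>t. g t * g t) x y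
        - (\<Sum>k\<le>n. (g (a + (b - a) * (k / n)) * g (a + (b - a) * (k / n)))
          * D (\<lambda>t. Bernstein n k ((t - a) / (b - a))) x y)\<bar> \<le> e * (norm x * norm y)"
      using approx[OF c(3) e] by (elim exE)
    define n where "n = max N1 (max N2 N3)"
    define F G where "F k = f (a + (b - a) * (real k / real n))"
      and "G k = g (a + (b - a) * (real k / real n))" for k
    define H where "H k = D (\<lambda>t. Bernstein n k ((t - a) / (b - a)))" for k
    have "0 \<le> F k * F k * H k x x + 2 * (F k * G k * H k x y) + G k * G k * H k y y" for k
    proof -
      define P where "P = \<Phi> (cfc (\<lambda>t. Bernstein n k ((t - a) / (b - a))) T)"
      have "0 \<le> P"
        unfolding P_def
      proof (intro unital_positive_nonneg[OF \<Phi>] cfc_nonneg[OF T])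
        show "continuous_on {a..b} (\<lambda>t. Bernstein n k ((t - a) / (b - a)))"
          unfolding Bernstein_def using ab by (intro continuous_intros) auto
        show "0 \<le> Bernstein n k ((t - a) / (b - a))" if "t \<in> {a..b}" for t
          using that ab by (intro Bernstein_nonneg) auto
      qed
      then have sa: "selfadjoint P" and "0 \<le> rinner (bop_apply P (F k *\<^sub>R x + G k *\<^sub>R y)) (F k *\<^sub>R x + G k *\<^sub>R y)"
        by (auto simp: zero_le_bop_iff)
      moreover have "rinner (bop_apply P y) x = rinner (bop_apply P x) y"
        using selfadjointD[OF sa, of y x] by (simp add: rinner_commute)
      ultimately show ?thesis
        by (simp add: H_def D_def P_def[symmetric] bop_simps rinner.add_left rinner.add_right
            rinner.scaleR_left rinner.scaleR_right algebra_simps)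
    qed
    then have "0 \<le> (\<Sum>k\<le>n. F k * F k * H k x x + 2 * (F k * G k * H k x y) + G k * G k * H k y y)"
      by (intro sum_nonneg)
    also have "\<dots> = (\<Sum>k\<le>n. F k * F k * H k x x) + 2 * (\<Sum>k\<le>n. F k * G k * H k x y) + (\<Sum>k\<le>n. G k * G k * H k y y)"
      by (simp add: sum.distrib sum_distrib_left)
    finally have S: "0 \<le> \<dots>" .
    have "\<bar>D (\<lambda>t. f t * f t) x x - (\<Sum>k\<le>n. F k * F k * H k x x)\<bar> \<le> e * (norm x * norm x)"
      "\<bar>D (\<lambda>t. f t * g t) x y - (\<Sum>k\<le>n. F k * G k * H k x y)\<bar> \<le> e * (norm x * norm y)"
      "\<bar>D (\<lambda>t. g t * g t) y y - (\<Sum>k\<le>n. G k * G k * H k y y)\<bar> \<le> e * (norm y * norm y)"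
      unfolding F_def G_def H_def using N1 N2 N3 by (simp_all only: n_def max.cobounded1 max.coboundedI2 max.cobounded2)
    moreover have "e * (norm x + norm y)\<^sup>2 = e * (norm x * norm x) + 2 * (e * (norm x * norm y)) + e * (norm y * norm y)"
      by (simp add: power2_eq_square algebra_simps)
    ultimately show "0 \<le> D (\<lambda>t. f t * f t) x x + 2 * D (\<lambda>t. f t * g t) x y + D (\<lambda>t. g t * g t) y y + e'"
      using S ee' by linarith
  qed
  then show ?thesis by (simp add: D_def)
qed

lemma unital_positive_powr_block:
  fixes \<Phi> :: "'a::chilbert bop \<Rightarrow> 'b::complex_inner bop"
  assumes \<Phi>: "unital_positive \<Phi>" and T: "strictly_positive T"
  shows "0 \<le> rinner (bop_apply (\<Phi> (T powr\<^sub>o \<mu>)) x) x + 2 * rinner (bop_apply (\<Phi> (T powr\<^sub>o ((\<mu> + \<nu>) / 2))) x) y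
    + rinner (bop_apply (\<Phi> (T powr\<^sub>o \<nu>)) y) y"
proof -
  obtain a b where ab: "0 < a" "a < b" "a *\<^sub>R 1 \<le> T" "T \<le> b *\<^sub>R 1"
    using strictly_positive_bounds[OF T] .
  have "t powr (\<mu>/2) * t powr (\<mu>/2) = t powr \<mu>" "t powr (\<mu>/2) * t powr (\<nu>/2) = t powr ((\<mu> + \<nu>) / 2)"
    "t powr (\<nu>/2) * t powr (\<nu>/2) = t powr \<nu>" for t :: real
    by (simp_all add: add_divide_distrib flip: powr_add)
  with positive_map_block_nonneg[OF \<Phi> ab(3,4,2) continuous_on_powr_interval[OF ab(1), where x = "\<mu>/2"]
      continuous_on_powr_interval[OF ab(1), where x = "\<nu>/2"], of x y]
  show ?thesis by (simp add: powr_op_def)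
qed

text \<open>
  A self-adjoint operator has norm equal to its spectral radius, which is invariant under similarity and at most
  one for a contraction.  Concretely \<open>\<parallel>Y\<parallel>\<^sup>n = \<parallel>Y\<^sup>n\<parallel>\<close> for \<open>n\<close> a power of two, while
  \<open>Y\<^sup>n = R W\<^sup>n R'\<close> stays bounded.
\<close>

lemma norm_le_1_of_similar_contraction:
  fixes Y W R R' :: "'a::chilbert bop"
  assumes Y: "selfadjoint Y" and YW: "Y = R * W * R'" and R: "R' * R = 1" and W: "norm W \<le> 1"
  shows "norm Y \<le> 1"
proof (rule ccontr)
  assume "\<not> norm Y \<le> 1"
  then have gt: "1 < norm Y" by simp
  have RR: "R' * (R * Z) = Z" for Z by (simp add: R flip: mult.assoc)
  have pow: "Y ^ Suc n = R * W ^ Suc n * R'" for n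
  proof (induction n)
    case (Suc n)
    have "Y ^ Suc (Suc n) = Y * Y ^ Suc n" by simp
    also have "\<dots> = R * W * R' * (R * W ^ Suc n * R')" by (simp only: Suc YW[symmetric])
    also have "\<dots> = R * W ^ Suc (Suc n) * R'" by (simp add: mult.assoc RR)
    finally show ?case .
  qed (use YW in simp)
  have two: "norm (Y ^ (2 ^ k)) = norm Y ^ (2 ^ k)" for k
  proof (induction k)
    case (Suc k)
    have "Y ^ (2 ^ Suc k) = Y ^ (2 ^ k) * Y ^ (2 ^ k)" by (simp add: mult_2 power_add)
    then show ?case
      using norm_square_selfadjoint[OF selfadjoint_power[OF Y, of "2 ^ k"]] Suc
      by (simp add: power2_eq_square mult_2 power_add)
  qed simp
  have bound: "norm Y ^ (2 ^ k) \<le> norm R * norm R'" for k :: nat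
  proof -
    obtain n where n: "(2::nat) ^ k = Suc n" by (metis not0_implies_Suc power_not_zero zero_neq_numeral)
    have "norm (Y ^ Suc n) \<le> norm (R * W ^ Suc n) * norm R'" unfolding pow by (rule norm_mult_ineq)
    also have "\<dots> \<le> norm R * norm (W ^ Suc n) * norm R'" by (intro mult_right_mono norm_mult_ineq) simp
    also have "\<dots> \<le> norm R * 1 * norm R'"
    proof (intro mult_right_mono mult_left_mono)
      have "norm (W ^ Suc n) \<le> norm W ^ Suc n" by (rule norm_bop_power)
      also have "\<dots> \<le> 1" using W by (intro power_le_one) auto
      finally show "norm (W ^ Suc n) \<le> 1" .
    qed auto
    finally show ?thesis using two[of k] n by simp
  qed
  obtain n where "norm R * norm R' < norm Y ^ n" using real_arch_pow[OF gt] by blast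
  also have "norm Y ^ n \<le> norm Y ^ (2 ^ n)"
    using gt by (intro power_increasing) (auto intro: less_imp_le)
  finally show False using bound[of n] by simp
qed

text \<open>
  The block hypothesis says that \<open>W = S\<^bsup>-\<nu>/2\<^esup> Z S\<^bsup>-\<mu>/2\<^esup>\<close> is a contraction.  The exponents on both sides
  differ, but \<open>W\<close> is similar to the symmetric \<open>Y = S\<^bsup>-c\<^esup> Z S\<^bsup>-c\<^esup>\<close> with \<open>c = (\<mu> + \<nu>)/4\<close>, so \<open>Y \<le> 1\<close>;
  multiply by \<open>S\<^bsup>c\<^esup>\<close> on both sides.
\<close>

lemma le_powr_midpoint_of_block:
  fixes S Z :: "'a::chilbert bop"
  assumes S: "strictly_positive S" and Z: "selfadjoint Z"
    and block: "\<And>x y. 0 \<le> rinner (bop_apply (S powr\<^sub>o \<mu>) x) x + 2 * rinner (bop_apply Z x) y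
      + rinner (bop_apply (S powr\<^sub>o \<nu>) y) y"
  shows "Z \<le> S powr\<^sub>o ((\<mu> + \<nu>) / 2)"
proof -
  note sa = selfadjoint_powr_op[OF S]
  define W where "W = S powr\<^sub>o (- \<nu>/2) * Z * S powr\<^sub>o (- \<mu>/2)"
  have iso: "rinner (bop_apply (S powr\<^sub>o c) (bop_apply (S powr\<^sub>o (- c/2)) u)) (bop_apply (S powr\<^sub>o (- c/2)) u)
    = (norm u)\<^sup>2" for c u
  proof -
    have "rinner (bop_apply (S powr\<^sub>o c) (bop_apply (S powr\<^sub>o (- c/2)) u)) (bop_apply (S powr\<^sub>o (- c/2)) u)
      = rinner (bop_apply (S powr\<^sub>o (- c/2) * (S powr\<^sub>o c * S powr\<^sub>o (- c/2))) u) u"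
      by (simp add: bop_apply_mult selfadjointD[OF sa])
    also have "S powr\<^sub>o (- c/2) * (S powr\<^sub>o c * S powr\<^sub>o (- c/2)) = 1"
      by (simp add: powr_op_zero[OF S] flip: powr_op_add[OF S])
    finally show ?thesis by (simp add: bop_apply_one rinner_self)
  qed
  have "norm W \<le> 1"
  proof (rule norm_bop_bound)
    fix u
    define v where "v = bop_apply W u"
    have "rinner (bop_apply Z (bop_apply (S powr\<^sub>o (- \<mu>/2)) u)) (bop_apply (S powr\<^sub>o (- \<nu>/2)) v) = (norm v)\<^sup>2"
      by (simp add: v_def W_def bop_apply_mult rinner_self[symmetric] flip: selfadjointD[OF sa])
    then have "0 \<le> (norm u)\<^sup>2 - 2 * (norm v)\<^sup>2 + (norm v)\<^sup>2"
      using block[of "bop_apply (S powr\<^sub>o (- \<mu>/2)) u" "- bop_apply (S powr\<^sub>o (- \<nu>/2)) v"] iso[of \<mu> u] iso[of \<nu> v]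
      by (simp add: bop_simps rinner.minus_left rinner.minus_right)
    then have "(norm v)\<^sup>2 \<le> (norm u)\<^sup>2" by simp
    then have "norm v \<le> norm u" by (rule power2_le_imp_le) simp
    then show "norm (bop_apply W u) \<le> 1 * norm u" by (simp add: v_def)
  qed simp
  define c d where "c = (\<mu> + \<nu>) / 4" and "d = (\<nu> - \<mu>) / 4"
  define Y where "Y = S powr\<^sub>o (- c) * Z * S powr\<^sub>o (- c)"
  have saY: "selfadjoint Y" unfolding Y_def by (intro selfadjoint_sandwich sa Z)
  have "Y = S powr\<^sub>o d * W * S powr\<^sub>o (- d)"
  proof -
    have e: "- c = d + - \<nu>/2" "- c = - \<mu>/2 + - d" by (simp_all add: c_def d_def field_simps)
    have "Y = S powr\<^sub>o (d + - \<nu>/2) * Z * S powr\<^sub>o (- \<mu>/2 + - d)"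
      unfolding Y_def by (metis e)
    also have "\<dots> = S powr\<^sub>o d * W * S powr\<^sub>o (- d)"
      unfolding powr_op_add[OF S] W_def by (simp add: mult.assoc)
    finally show ?thesis .
  qed
  then have "norm Y \<le> 1"
    by (rule norm_le_1_of_similar_contraction[OF saY _ powr_op_minus_cancel(1)[OF S] \<open>norm W \<le> 1\<close>])
  then have "Y \<le> 1"
    using selfadjoint_le_norm[OF saY] scaleR_one_mono[of "norm Y" 1, where 'a = 'a] by (auto intro: order_trans)
  then have "S powr\<^sub>o c * Y * S powr\<^sub>o c \<le> S powr\<^sub>o c * 1 * S powr\<^sub>o c"
    by (rule sandwich_mono[OF sa])
  moreover have "S powr\<^sub>o c * Y * S powr\<^sub>o c = Z"
  proof -
    have "S powr\<^sub>o c * Y * S powr\<^sub>o c = (S powr\<^sub>o c * S powr\<^sub>o (- c)) * Z * (S powr\<^sub>o (- c) * S powr\<^sub>o c)"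
      by (simp only: Y_def mult.assoc)
    then show ?thesis by (simp add: powr_op_minus_cancel[OF S])
  qed
  moreover have "S powr\<^sub>o c * 1 * S powr\<^sub>o c = S powr\<^sub>o ((\<mu> + \<nu>) / 2)"
    by (simp add: c_def flip: powr_op_add[OF S])
  ultimately show ?thesis by simp
qed

text \<open>
  The exponents that satisfy the claim contain 0 and 1, are closed under midpoints (by the block inequality for
  \<open>\<Phi>\<close> and the previous lemma) and are closed, hence fill the unit interval.  For \<open>S = \<Phi> T\<close> this is Jensen's
  operator inequality for the concave function \<open>t\<^bsup>\<nu>\<^esup>\<close>; for the identity map it is the Loewner-Heinz inequality.
\<close>

theorem unital_positive_powr_le:
  fixes \<Phi> :: "'a::chilbert bop \<Rightarrow> 'b::chilbert bop"
  assumes \<Phi>: "unital_positive \<Phi>" and T: "strictly_positive T" and S: "strictly_positive S"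
    and le: "\<Phi> T \<le> S" and \<nu>: "0 \<le> \<nu>" "\<nu> \<le> 1"
  shows "\<Phi> (T powr\<^sub>o \<nu>) \<le> S powr\<^sub>o \<nu>"
proof -
  define P where "P \<nu> \<longleftrightarrow> \<Phi> (T powr\<^sub>o \<nu>) \<le> S powr\<^sub>o \<nu>" for \<nu>
  have sa: "selfadjoint (\<Phi> (T powr\<^sub>o \<nu>))" for \<nu>
    by (intro selfadjoint_strictly_positive strictly_positive_unital_positive[OF \<Phi>] strictly_positive_powr_op T)
  have P0: "P 0" by (simp add: P_def powr_op_zero T S unital_positive_simps[OF \<Phi>])
  have P1: "P 1" using le by (simp add: P_def powr_op_one T S)
  have mid: "P ((\<mu> + \<nu>) / 2)" if "P \<mu>" "P \<nu>" for \<mu> \<nu>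
    unfolding P_def
  proof (rule le_powr_midpoint_of_block[OF S sa])
    fix x y
    have "rinner (bop_apply (\<Phi> (T powr\<^sub>o \<mu>)) x) x \<le> rinner (bop_apply (S powr\<^sub>o \<mu>) x) x"
      "rinner (bop_apply (\<Phi> (T powr\<^sub>o \<nu>)) y) y \<le> rinner (bop_apply (S powr\<^sub>o \<nu>) y) y"
      using that by (auto simp: P_def le_bop_iff)
    with unital_positive_powr_block[OF \<Phi> T, of \<mu> x \<nu> y]
    show "0 \<le> rinner (bop_apply (S powr\<^sub>o \<mu>) x) x + 2 * rinner (bop_apply (\<Phi> (T powr\<^sub>o ((\<mu> + \<nu>) / 2))) x) y
      + rinner (bop_apply (S powr\<^sub>o \<nu>) y) y" by linarith
  qed
  have dyadic: "k \<le> 2 ^ n \<Longrightarrow> P (real k / 2 ^ n)" for n k :: nat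
  proof (induction n arbitrary: k)
    case 0
    then have "k = 0 \<or> k = 1" by auto
    then show ?case using P0 P1 by auto
  next
    case (Suc n)
    show ?case
    proof (cases "even k")
      case True
      then obtain j where "k = 2 * j" by blast
      with Suc show ?thesis by simp
    next
      case False
      then obtain j where j: "k = 2 * j + 1" by (rule oddE)
      with Suc.prems have "j \<le> 2 ^ n" "Suc j \<le> 2 ^ n" by auto
      then have "P ((real j / 2 ^ n + real (Suc j) / 2 ^ n) / 2)" by (intro mid Suc.IH)
      moreover have "(real j / 2 ^ n + real (Suc j) / 2 ^ n) / 2 = real k / 2 ^ Suc n"
        by (simp add: j field_simps)
      ultimately show ?thesis by (simp only:)
    qed
  qed
  have "P \<nu>" unfolding P_def
  proof (rule le_add_eps_imp_le[OF sa selfadjoint_powr_op[OF S]])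
    fix e :: real assume e: "0 < e"
    obtain d1 where d1: "0 < d1"
      "\<And>y. \<bar>y - \<nu>\<bar> < d1 \<Longrightarrow> T powr\<^sub>o y \<le> T powr\<^sub>o \<nu> + (e/2) *\<^sub>R 1 \<and> T powr\<^sub>o \<nu> \<le> T powr\<^sub>o y + (e/2) *\<^sub>R 1"
      using powr_op_exponent_continuous[OF T, of "e/2" \<nu>] e half_gt_zero by blast
    obtain d2 where d2: "0 < d2"
      "\<And>y. \<bar>y - \<nu>\<bar> < d2 \<Longrightarrow> S powr\<^sub>o y \<le> S powr\<^sub>o \<nu> + (e/2) *\<^sub>R 1 \<and> S powr\<^sub>o \<nu> \<le> S powr\<^sub>o y + (e/2) *\<^sub>R 1"
      using powr_op_exponent_continuous[OF S, of "e/2" \<nu>] e half_gt_zero by blast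
    obtain n where n: "(1/2::real) ^ n < min d1 d2"
      using real_arch_pow_inv[of "min d1 d2" "1/2"] d1 d2 by auto
    \<comment> \<open>A dyadic exponent within \<open>2\<^bsup>-n\<^esup>\<close> of \<open>\<nu>\<close>.\<close>
    define k where "k = nat \<lfloor>\<nu> * 2 ^ n\<rfloor>"
    have rk: "real k = of_int \<lfloor>\<nu> * 2 ^ n\<rfloor>" using \<nu> by (simp add: k_def)
    then have k: "real k \<le> \<nu> * 2 ^ n" "\<nu> * 2 ^ n < real k + 1" by linarith+
    have "\<nu> * 2 ^ n \<le> 2 ^ n" using \<nu> by simp
    with k(1) have "real k \<le> 2 ^ n" by (rule order_trans)
    then have "k \<le> 2 ^ n" by simp
    then have Pk: "P (real k / 2 ^ n)" by (rule dyadic)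
    have "\<bar>real k / 2 ^ n - \<nu>\<bar> < (1/2) ^ n"
    proof -
      have "real k / 2 ^ n \<le> \<nu>" "\<nu> < (real k + 1) / 2 ^ n"
        using k by (simp_all add: pos_divide_le_eq pos_less_divide_eq)
      then show ?thesis by (simp add: power_one_over add_divide_distrib)
    qed
    then have close: "\<bar>real k / 2 ^ n - \<nu>\<bar> < d1" "\<bar>real k / 2 ^ n - \<nu>\<bar> < d2" using n by auto
    have "\<Phi> (T powr\<^sub>o \<nu>) \<le> \<Phi> (T powr\<^sub>o (real k / 2 ^ n)) + (e/2) *\<^sub>R 1"
      using unital_positive_mono[OF \<Phi> conjunct2[OF d1(2)[OF close(1)]]] by (simp add: unital_positive_simps[OF \<Phi>])
    also have "\<dots> \<le> S powr\<^sub>o (real k / 2 ^ n) + (e/2) *\<^sub>R 1" using Pk by (simp add: P_def)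
    also have "\<dots> \<le> S powr\<^sub>o \<nu> + (e/2) *\<^sub>R 1 + (e/2) *\<^sub>R 1" using d2(2)[OF close(2)] by simp
    also have "\<dots> = S powr\<^sub>o \<nu> + e *\<^sub>R 1" by (simp add: add.assoc flip: scaleR_add_left)
    finally show "\<Phi> (T powr\<^sub>o \<nu>) \<le> S powr\<^sub>o \<nu> + e *\<^sub>R 1" .
  qed
  then show ?thesis by (simp add: P_def)
qed

corollary Loewner_Heinz:
  fixes S T :: "'a::chilbert bop"
  assumes "strictly_positive T" "T \<le> S" "0 \<le> \<nu>" "\<nu> \<le> 1"
  shows "T powr\<^sub>o \<nu> \<le> S powr\<^sub>o \<nu>"
  using unital_positive_powr_le[OF unital_positive_id assms(1) strictly_positive_mono[OF assms(1,2)] assms(2-4)] .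

text \<open>
  The counterpart for the exponent \<open>-1\<close>: the block inequality for the exponents \<open>1\<close> and \<open>-1\<close> has the identity off
  the diagonal, and minimizing over \<open>x\<close> gives \<open>x = - Q\<^sup>-\<^sup>1 y\<close>.  It combines Choi's inequality
  \<open>\<Phi>(G)\<^sup>-\<^sup>1 \<le> \<Phi>(G\<^sup>-\<^sup>1)\<close> with the antitonicity of the inverse.
\<close>

lemma inv_op_le_of_unital_positive_le:
  fixes \<Phi> :: "'a::chilbert bop \<Rightarrow> 'b::chilbert bop"
  assumes \<Phi>: "unital_positive \<Phi>" and G: "strictly_positive G" and Q: "\<Phi> G \<le> Q"
  shows "inv_op Q \<le> \<Phi> (inv_op G)"
proof -
  have "strictly_positive Q"
    using strictly_positive_mono[OF strictly_positive_unital_positive[OF \<Phi> G] Q] .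
  note Qi = inv_op_cancel[OF this] and sa = selfadjoint_strictly_positive[OF strictly_positive_inv_op[OF this]]
  have "rinner (bop_apply (inv_op Q) y) y \<le> rinner (bop_apply (\<Phi> (inv_op G)) y) y" for y
  proof -
    define x where "x = - bop_apply (inv_op Q) y"
    have "0 \<le> rinner (bop_apply (\<Phi> G) x) x + 2 * rinner x y + rinner (bop_apply (\<Phi> (inv_op G)) y) y"
      using unital_positive_powr_block[OF \<Phi> G, of 1 x "-1" y]
      by (simp add: powr_op_one[OF G] powr_op_zero[OF G] unital_positive_simps[OF \<Phi>] bop_apply_one
          inv_op_eq_powr_op[OF G])
    moreover have "rinner (bop_apply (\<Phi> G) x) x \<le> rinner (bop_apply Q x) x"
      using Q by (simp add: le_bop_iff)
    moreover have "bop_apply Q x = - y"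
      by (simp add: x_def bop_apply_diff Qi bop_apply_one flip: bop_apply_mult)
    then have "rinner (bop_apply Q x) x = - rinner x y" by (simp add: rinner.minus_left rinner_commute[of y x])
    ultimately show ?thesis by (simp add: x_def rinner.minus_left)
  qed
  moreover have "selfadjoint (\<Phi> (inv_op G))"
    by (intro selfadjoint_strictly_positive strictly_positive_unital_positive[OF \<Phi>] strictly_positive_inv_op G)
  ultimately show ?thesis by (simp add: le_bop_iff selfadjoint_diff sa)
qed

section \<open>A refined Young inequality and a Kantorovich bound\<close>

text \<open>
  The left-hand correction is \<open>r (1 - \<surd>u)\<^sup>2\<close>.  For \<open>\<nu> \<le> 1/2\<close>, subtracting it from the right-hand side leaves the weighted mean
  \<open>(1 - 2\<nu>) \<cdot> 1 + 2\<nu> \<surd>u\<close>, and for \<open>\<nu> > 1/2\<close> it leaves \<open>(2\<nu> - 1) u + 2(1 - \<nu>) \<surd>u\<close>.  In both cases the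
  corresponding weighted geometric mean is \<open>u\<^bsup>\<nu>\<^esup>\<close>.
\<close>

lemma refined_young_scalar:
  fixes u \<nu> r :: real
  assumes u: "0 < u" and \<nu>: "0 \<le> \<nu>" "\<nu> \<le> 1" and r: "r = min \<nu> (1 - \<nu>)"
  shows "u powr \<nu> + r * (1 + u - 2 * u powr (1/2)) \<le> (1 - \<nu>) + \<nu> * u"
proof (cases "\<nu> \<le> 1/2")
  case True
  have "1 powr (1 - 2 * \<nu>) * (u powr (1/2)) powr (2 * \<nu>) \<le> (1 - 2 * \<nu>) * 1 + 2 * \<nu> * u powr (1/2)"
    using True \<nu> u by (intro Youngs_inequality_0) auto
  then have "u powr \<nu> \<le> 1 - 2 * \<nu> + 2 * \<nu> * u powr (1/2)" by (simp add: powr_powr)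
  moreover have "r = \<nu>" using True r by simp
  ultimately show ?thesis by (simp add: algebra_simps)
next
  case False
  have "u powr (2 * \<nu> - 1) * (u powr (1/2)) powr (2 * (1 - \<nu>)) \<le> (2 * \<nu> - 1) * u + 2 * (1 - \<nu>) * u powr (1/2)"
    using False \<nu> u by (intro Youngs_inequality_0) auto
  moreover have "u powr (2 * \<nu> - 1) * (u powr (1/2)) powr (2 * (1 - \<nu>)) = u powr \<nu>"
  proof -
    have "2 * \<nu> - 1 + 1 / 2 * (2 * (1 - \<nu>)) = \<nu>" by (simp add: field_simps)
    then show ?thesis unfolding powr_powr powr_add[symmetric] by (rule arg_cong)
  qed
  ultimately have "u powr \<nu> \<le> (2 * \<nu> - 1) * u + 2 * (1 - \<nu>) * u powr (1/2)" by (simp only:)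
  moreover have r': "r = 1 - \<nu>" using False r by simp
  ultimately show ?thesis unfolding r' by (simp add: algebra_simps)
qed

lemma refined_young_op:
  fixes U :: "'a::chilbert bop"
  assumes U: "strictly_positive U" and \<nu>: "0 \<le> \<nu>" "\<nu> \<le> 1" and r: "r = min \<nu> (1 - \<nu>)"
  shows "U powr\<^sub>o \<nu> + r *\<^sub>R (1 + U - 2 *\<^sub>R U powr\<^sub>o (1/2)) \<le> (1 - \<nu>) *\<^sub>R 1 + \<nu> *\<^sub>R U"
proof -
  obtain a b where ab: "0 < a" "a < b" and U': "a *\<^sub>R 1 \<le> U" "U \<le> b *\<^sub>R 1"
    using strictly_positive_bounds[OF U] .
  note c = continuous_on_powr_interval[OF ab(1)]
  have "cfc (\<lambda>u. u powr \<nu> + r * (1 + u - 2 * u powr (1/2))) U \<le> cfc (\<lambda>u. (1 - \<nu>) + \<nu> * u) U"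
    using ab by (intro cfc_mono[OF U'] refined_young_scalar \<nu> r continuous_intros c) auto
  also have "cfc (\<lambda>u. u powr \<nu> + r * (1 + u - 2 * u powr (1/2))) U
      = U powr\<^sub>o \<nu> + r *\<^sub>R (1 + U - 2 *\<^sub>R U powr\<^sub>o (1/2))"
    by (simp add: cfc_add[OF U'] cfc_diff[OF U'] cfc_scaleR[OF U'] cfc_const[OF U'] cfc_id[OF U']
        continuous_intros c powr_op_def)
  also have "cfc (\<lambda>u. (1 - \<nu>) + \<nu> * u) U = (1 - \<nu>) *\<^sub>R 1 + \<nu> *\<^sub>R U"
    by (simp add: cfc_add[OF U'] cfc_scaleR[OF U'] cfc_const[OF U'] cfc_id[OF U'] continuous_intros)
  finally show ?thesis .
qed

text \<open>
  The scalar inequality is \<open>(M - t) (t - m) \<ge> 0\<close> divided by \<open>t\<close>.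
\<close>

lemma add_scaled_inv_op_le:
  fixes A :: "'a::chilbert bop"
  assumes m: "0 < m" and A: "m *\<^sub>R 1 \<le> A" "A \<le> M *\<^sub>R 1"
  shows "A + (M * m) *\<^sub>R inv_op A \<le> (M + m) *\<^sub>R 1"
proof -
  note c = continuous_on_powr_interval[OF m]
  have "cfc (\<lambda>t. t + (M * m) * t powr (-1)) A \<le> cfc (\<lambda>_. M + m) A"
  proof (intro cfc_mono[OF A] continuous_intros c)
    fix t assume t: "t \<in> {m..M}"
    then have "0 \<le> (M - t) * (t - m)" by simp
    then have "t * t + M * m \<le> (M + m) * t" by (simp add: algebra_simps)
    then show "t + M * m * t powr (-1) \<le> M + m"
      using t m by (simp add: powr_minus field_simps)
  qed (use m in auto)
  also have "cfc (\<lambda>t. t + (M * m) * t powr (-1)) A = A + (M * m) *\<^sub>R inv_op A"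
  proof -
    have "cfc (\<lambda>t. t + (M * m) * t powr (-1)) A = cfc (\<lambda>t. t) A + cfc (\<lambda>t. (M * m) * t powr (-1)) A"
      by (intro cfc_add[OF A] continuous_on_mult c continuous_on_const continuous_on_id)
    then show ?thesis
      by (simp only: cfc_id[OF A] cfc_scaleR[OF A c] powr_op_def
          inv_op_eq_powr_op[OF strictly_positiveI[OF m A(1)]])
  qed
  finally show ?thesis by (simp add: cfc_const[OF A])
qed

section \<open>From a bound on a sum to a comparison of powers\<close>

text \<open>
  This is the operator arithmetic-geometric mean bound \<open>\<parallel>E F\<parallel> \<le> \<parallel>E + F\<parallel>\<^sup>2 / 4\<close>, for \<open>G = F\<^sup>-\<^sup>1\<close>.  From \<open>F \<le> 1 - E\<close> one
  expects \<open>G \<ge> (1 - E)\<^sup>-\<^sup>1 \<ge> 1 + 4 E\<^sup>2\<close>, the last step because the scalar difference times \<open>1 - e\<close> is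
  \<open>e (1 - 2e)\<^sup>2\<close>.  Squaring does not preserve the order, but
  \<open>\<parallel>x\<parallel> \<parallel>G x\<parallel> \<ge> rinner x (G x) \<ge> \<parallel>x\<parallel>\<^sup>2 + 4 \<parallel>E x\<parallel>\<^sup>2 \<ge> 4 \<parallel>x\<parallel> \<parallel>E x\<parallel>\<close> is enough.
\<close>

lemma scaled_square_le_of_add_le_one:
  fixes E F G :: "'a::complex_inner bop"
  assumes E: "0 \<le> E" and F: "0 \<le> F" and G: "selfadjoint G" and FG: "F * G = 1" and EF: "E + F \<le> 1"
  shows "16 *\<^sub>R (E * E) \<le> G * G"
proof -
  have saE: "selfadjoint E" and saF: "selfadjoint F" using E F by (auto simp: zero_le_bop_iff)
  note symE = selfadjointD[OF saE] and symF = selfadjointD[OF saF]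
  have "4 * norm (bop_apply E x) \<le> norm (bop_apply G x)" for x
  proof (cases "x = 0")
    case True
    have "bop_apply X 0 = 0" for X :: "'a bop" using bop_apply_scaleR(2)[of X 0 0] by simp
    then show ?thesis by (simp only: True norm_zero mult_zero_right order_refl)
  next
    case False
    define u where "u = bop_apply E x"
    \<comment> \<open>The vector \<open>w = (1 + 2E) x\<close> stands in for the optimal \<open>(1 - E)\<^sup>-\<^sup>1 x\<close>; the two agree at the spectral
      values \<open>0\<close> and \<open>1/2\<close>, where equality holds, and \<open>1 - E\<close> need not be invertible.\<close>
    define w where "w = x + 2 *\<^sub>R u"
    define g where "g = bop_apply G x"
    have Fg: "bop_apply F g = x" unfolding g_def by (metis FG bop_apply_mult bop_apply_one)
    have "0 \<le> rinner (bop_apply F (w - g)) (w - g)" using F by (simp add: zero_le_bop_iff)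
    moreover have "rinner (bop_apply F (w - g)) (w - g) = rinner (bop_apply F w) w - 2 * rinner x w + rinner x g"
      using symF[of w g] by (simp add: bop_simps rinner.diff_left rinner.diff_right Fg rinner_commute)
    moreover have "rinner (bop_apply F w) w \<le> rinner w w - rinner (bop_apply E w) w"
      using EF by (auto simp: le_bop_iff bop_simps rinner.add_left dest!: spec[of _ w])
    ultimately have 1: "2 * rinner x w - rinner w w + rinner (bop_apply E w) w \<le> rinner x g" by linarith
    \<comment> \<open>The operator form of \<open>e (1 - 2e)\<^sup>2 \<ge> 0\<close>.\<close>
    have "0 \<le> rinner (bop_apply E (x - 2 *\<^sub>R u)) (x - 2 *\<^sub>R u)" using E by (simp add: zero_le_bop_iff)
    then have 2: "0 \<le> rinner u x - 4 * rinner u u + 4 * rinner (bop_apply E u) u"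
      using symE[of u x] by (simp add: bop_simps rinner.diff_left rinner.diff_right
          rinner.scaleR_left rinner.scaleR_right flip: u_def)
    have "2 * rinner x w - rinner w w + rinner (bop_apply E w) w
      = rinner x x + rinner u x + 4 * rinner (bop_apply E u) u"
      using symE[of u x] rinner_commute[of x u] by (simp add: w_def bop_simps rinner.add_left rinner.add_right
          rinner.scaleR_left rinner.scaleR_right flip: u_def)
    with 1 2 have "(norm x)\<^sup>2 + 4 * (norm u)\<^sup>2 \<le> rinner x g" by (simp add: rinner_self)
    also have "\<dots> \<le> norm x * norm g" by (rule Cauchy_Schwarz_rinner)
    finally have "(norm x)\<^sup>2 + 4 * (norm u)\<^sup>2 \<le> norm x * norm g" .
    moreover have "0 \<le> (norm x - 2 * norm u)\<^sup>2" by simp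
    ultimately have "norm x * (4 * norm u) \<le> norm x * norm g"
      by (simp add: power2_diff power_mult_distrib)
    then show ?thesis using False by (simp add: u_def g_def)
  qed
  then have "(4 * norm (bop_apply E x))\<^sup>2 \<le> (norm (bop_apply G x))\<^sup>2" for x
    by (intro power_mono) auto
  then have "rinner (bop_apply (16 *\<^sub>R (E * E)) x) x \<le> rinner (bop_apply (G * G) x) x" for x
    using symE selfadjointD[OF G]
    by (simp add: bop_apply_scaleR bop_apply_mult rinner.scaleR_left rinner_self power_mult_distrib)
  then show ?thesis
    using saE G by (simp add: le_bop_iff selfadjoint_diff selfadjoint_scaleR selfadjoint_mult)
qed

lemma powr_op_inv_op:
  "strictly_positive (X :: 'a::chilbert bop) \<Longrightarrow> inv_op X powr\<^sub>o x = X powr\<^sub>o (- x)"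
  by (simp add: inv_op_eq_powr_op powr_op_powr_op)

text \<open>
  Scaled by \<open>1/L\<close>, both summands are at most one, so raising them to the power \<open>s = p/2 \<ge> 1\<close> makes them smaller and
  their sum remains at most one.  The comparison of squares then applies to these powers.
\<close>

lemma powr_op_ge_2_le_of_add_inv_op_le:
  fixes P Q :: "'a::chilbert bop"
  assumes P: "strictly_positive P" and Q: "strictly_positive Q" and h: "0 < h" and L: "0 < L"
    and le: "P + h *\<^sub>R inv_op Q \<le> L *\<^sub>R 1" and p: "2 \<le> p"
  shows "P powr\<^sub>o p \<le> ((L\<^sup>2 / h) powr p / 16) *\<^sub>R Q powr\<^sub>o p"
proof -
  define s where "s = p / 2"
  have s: "1 \<le> s" "s + s = p" using p by (auto simp: s_def)
  define C D where "C = (1 / L) *\<^sub>R P" and "D = (h / L) *\<^sub>R inv_op Q"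
  note Qi = strictly_positive_inv_op[OF Q]
  have C: "strictly_positive C" and D: "strictly_positive D"
    using L h unfolding C_def D_def by (intro strictly_positive_scaleR P Qi divide_pos_pos; simp)+
  have "(1 / L) *\<^sub>R (P + h *\<^sub>R inv_op Q) \<le> (1 / L) *\<^sub>R (L *\<^sub>R 1)"
    using L by (intro scaleR_left_mono le) auto
  then have CD: "C + D \<le> 1" using L by (simp add: C_def D_def scaleR_add_right)
  have C1: "C \<le> 1" and D1: "D \<le> 1"
    using CD strictly_positive_nonneg[OF C] strictly_positive_nonneg[OF D] 
      le_add_same_cancel1[of C D] le_add_same_cancel2[of D C] order_trans by blast+
  have "C powr\<^sub>o s + D powr\<^sub>o s \<le> C + D"
    by (intro add_mono powr_op_le_self C D C1 D1 s)
  then have "C powr\<^sub>o s + D powr\<^sub>o s \<le> 1" using CD by (rule order_trans)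
  then have "16 *\<^sub>R (C powr\<^sub>o s * C powr\<^sub>o s) \<le> D powr\<^sub>o (- s) * D powr\<^sub>o (- s)"
    by (intro scaled_square_le_of_add_le_one[where F = "D powr\<^sub>o s"] strictly_positive_nonneg
        strictly_positive_powr_op selfadjoint_powr_op powr_op_minus_cancel C D)
  then have *: "16 *\<^sub>R C powr\<^sub>o p \<le> D powr\<^sub>o (- p)"
    using s by (simp flip: powr_op_add[OF C] powr_op_add[OF D])
  have "C powr\<^sub>o p = (1 / L) powr p *\<^sub>R P powr\<^sub>o p"
    unfolding C_def using L by (intro powr_op_scaleR P) simp
  moreover have "D powr\<^sub>o (- p) = (h / L) powr (- p) *\<^sub>R Q powr\<^sub>o p"
    unfolding D_def using L h by (simp add: powr_op_scaleR[OF Qi] powr_op_inv_op[OF Q])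
  ultimately have "(16 * (1 / L) powr p) *\<^sub>R P powr\<^sub>o p \<le> (h / L) powr (- p) *\<^sub>R Q powr\<^sub>o p"
    using * by simp
  then have "(L powr p / 16) *\<^sub>R (16 * (1 / L) powr p) *\<^sub>R P powr\<^sub>o p
    \<le> (L powr p / 16) *\<^sub>R (h / L) powr (- p) *\<^sub>R Q powr\<^sub>o p"
    by (intro scaleR_left_mono) auto
  moreover have "(L powr p / 16) * (16 * (1 / L) powr p) = 1" using L by (simp add: powr_divide)
  moreover have "(L powr p / 16) * (h / L) powr (- p) = (L\<^sup>2 / h) powr p / 16"
    using L h by (simp add: powr_divide powr_minus power2_eq_square powr_mult field_simps)
  ultimately show ?thesis by simp
qed

text \<open>
  For \<open>p \<ge> 2\<close> the constant is \<open>L\<^sup>2 / (4\<^bsup>2/p\<^esup> h)\<close>, since \<open>(4\<^bsup>2/p\<^esup>)\<^bsup>p\<^esup> = 16\<close>.  For \<open>p < 2\<close> the case \<open>p = 2\<close> is raised to the power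
  \<open>p/2 \<le> 1\<close> by the Loewner-Heinz inequality, and the constant is \<open>L\<^sup>2 / (4 h)\<close>.
\<close>

lemma powr_op_le_of_add_inv_op_le:
  fixes P Q :: "'a::chilbert bop"
  assumes P: "strictly_positive P" and Q: "strictly_positive Q" and h: "0 < h" and L: "0 < L"
    and le: "P + h *\<^sub>R inv_op Q \<le> L *\<^sub>R 1" and p: "0 < p"
    and \<alpha>: "L\<^sup>2 / (4 * h) \<le> \<alpha>" "L\<^sup>2 / (4 powr (2 / p) * h) \<le> \<alpha>"
  shows "P powr\<^sub>o p \<le> \<alpha> powr p *\<^sub>R Q powr\<^sub>o p"
proof (cases "2 \<le> p")
  case True
  have "(4 powr (2 / p)) powr p = (4::real) ^ 2"
    using p by (simp add: powr_powr flip: powr_realpow)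
  then have "(L\<^sup>2 / h) powr p / 16 = (L\<^sup>2 / (4 powr (2 / p) * h)) powr p"
    using L h by (simp add: powr_divide powr_mult)
  also have "\<dots> \<le> \<alpha> powr p" using \<alpha> h p by (intro powr_mono2) auto
  finally have "((L\<^sup>2 / h) powr p / 16) *\<^sub>R Q powr\<^sub>o p \<le> \<alpha> powr p *\<^sub>R Q powr\<^sub>o p"
    by (intro scaleR_right_mono strictly_positive_nonneg strictly_positive_powr_op Q)
  with powr_op_ge_2_le_of_add_inv_op_le[OF P Q h L le True] show ?thesis by (rule order_trans)
next
  case False
  define c where "c = L\<^sup>2 / (4 * h)"
  have c: "0 < c" using L h by (simp add: c_def)
  have c2: "(L\<^sup>2 / h) powr 2 / 16 = c powr 2"
    using L h by (simp add: c_def powr_divide powr_mult)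
  have "P powr\<^sub>o 2 \<le> c powr 2 *\<^sub>R Q powr\<^sub>o 2"
    using powr_op_ge_2_le_of_add_inv_op_le[OF P Q h L le order_refl] by (simp only: c2)
  then have "(P powr\<^sub>o 2) powr\<^sub>o (p/2) \<le> (c powr 2 *\<^sub>R Q powr\<^sub>o 2) powr\<^sub>o (p/2)"
    using False p by (intro Loewner_Heinz strictly_positive_powr_op P) auto
  also have "(c powr 2 *\<^sub>R Q powr\<^sub>o 2) powr\<^sub>o (p/2) = (c powr 2) powr (p/2) *\<^sub>R (Q powr\<^sub>o 2) powr\<^sub>o (p/2)"
    using c by (intro powr_op_scaleR strictly_positive_powr_op Q) simp
  finally have "P powr\<^sub>o p \<le> c powr p *\<^sub>R Q powr\<^sub>o p"
    by (simp add: powr_op_powr_op P Q powr_powr)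
  also have "\<dots> \<le> \<alpha> powr p *\<^sub>R Q powr\<^sub>o p"
    using \<alpha> c p by (intro scaleR_right_mono powr_mono2 strictly_positive_nonneg strictly_positive_powr_op Q)
      (auto simp: c_def)
  finally show ?thesis .
qed

section \<open>Weighted geometric means\<close>

lemma sandwich_powr_op_cancel:
  fixes A X :: "'a::chilbert bop"
  assumes A: "strictly_positive A"
  shows "A powr\<^sub>o x * (A powr\<^sub>o (-x) * X * A powr\<^sub>o (-x)) * A powr\<^sub>o x = X"
proof -
  have "A powr\<^sub>o x * (A powr\<^sub>o (-x) * X * A powr\<^sub>o (-x)) * A powr\<^sub>o x
    = (A powr\<^sub>o x * A powr\<^sub>o (-x)) * X * (A powr\<^sub>o (-x) * A powr\<^sub>o x)"
    by (simp only: mult.assoc)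
  then show ?thesis by (simp add: powr_op_minus_cancel[OF A])
qed

lemma strictly_positive_geom_mean:
  fixes A B :: "'a::chilbert bop"
  assumes "strictly_positive A" "strictly_positive B"
  shows "strictly_positive (geom_mean \<nu> A B)"
  unfolding geom_mean_def by (intro strictly_positive_sandwich strictly_positive_powr_op assms)

lemma inv_op_sandwich:
  fixes A B :: "'a::chilbert bop"
  assumes A: "strictly_positive A" and B: "strictly_positive B"
  shows "inv_op (A powr\<^sub>o x * B * A powr\<^sub>o x) = A powr\<^sub>o (-x) * inv_op B * A powr\<^sub>o (-x)"
proof (rule inv_op_eqI)
  have c: "A powr\<^sub>o x * (A powr\<^sub>o (-x) * Z) = Z" "A powr\<^sub>o (-x) * (A powr\<^sub>o x * Z) = Z"
    "B * (inv_op B * Z) = Z" "inv_op B * (B * Z) = Z" for Z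
    by (simp_all add: powr_op_minus_cancel[OF A] inv_op_cancel[OF B] flip: mult.assoc)
  show "A powr\<^sub>o x * B * A powr\<^sub>o x * (A powr\<^sub>o (-x) * inv_op B * A powr\<^sub>o (-x)) = 1"
    "A powr\<^sub>o (-x) * inv_op B * A powr\<^sub>o (-x) * (A powr\<^sub>o x * B * A powr\<^sub>o x) = 1"
    by (simp_all add: mult.assoc c powr_op_minus_cancel[OF A])
qed

lemma inv_op_geom_mean:
  fixes A B :: "'a::chilbert bop"
  assumes A: "strictly_positive A" and B: "strictly_positive B"
  shows "inv_op (geom_mean \<nu> A B) = geom_mean \<nu> (inv_op A) (inv_op B)"
proof -
  define T where "T = A powr\<^sub>o (-1/2) * B * A powr\<^sub>o (-1/2)"
  have T: "strictly_positive T" unfolding T_def by (intro strictly_positive_sandwich A B)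
  have "inv_op (geom_mean \<nu> A B) = A powr\<^sub>o (-1/2) * inv_op (T powr\<^sub>o \<nu>) * A powr\<^sub>o (-1/2)"
    unfolding geom_mean_def T_def[symmetric]
    using inv_op_sandwich[OF A strictly_positive_powr_op[OF T], of "1/2" \<nu>] by simp
  also have "inv_op (T powr\<^sub>o \<nu>) = inv_op T powr\<^sub>o \<nu>"
    by (simp add: inv_op_eq_powr_op T strictly_positive_powr_op powr_op_powr_op)
  also have "inv_op T = A powr\<^sub>o (1/2) * inv_op B * A powr\<^sub>o (1/2)"
    using inv_op_sandwich[OF A B, of "-1/2"] by (simp add: T_def)
  finally show ?thesis by (simp add: geom_mean_def powr_op_inv_op[OF A])
qed

text \<open>
  Both means and the correction are \<open>A\<^bsup>1/2\<^esup> f(U) A\<^bsup>1/2\<^esup>\<close> for the single operator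
  \<open>U = A\<^bsup>-1/2\<^esup> B A\<^bsup>-1/2\<^esup>\<close>, which reduces the claim to functions of \<open>U\<close>.
\<close>

lemma refined_young_geom_mean:
  fixes A B :: "'a::chilbert bop"
  assumes A: "strictly_positive A" and B: "strictly_positive B"
    and \<nu>: "0 \<le> \<nu>" "\<nu> \<le> 1" and r: "r = min \<nu> (1 - \<nu>)"
  shows "geom_mean \<nu> A B + (2 * r) *\<^sub>R (arith_mean (1/2) A B - geom_mean (1/2) A B) \<le> arith_mean \<nu> A B"
proof -
  define C where "C = A powr\<^sub>o (1/2)"
  define U where "U = A powr\<^sub>o (-1/2) * B * A powr\<^sub>o (-1/2)"
  have gm: "geom_mean x A B = C * U powr\<^sub>o x * C" for x by (simp only: geom_mean_def C_def U_def)
  have U: "strictly_positive U" unfolding U_def by (intro strictly_positive_sandwich A B)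
  have CC: "C * C = A" using powr_op_add[OF A, of "1/2" "1/2"] by (simp add: C_def powr_op_one[OF A])
  have CUC: "C * U * C = B" using sandwich_powr_op_cancel[OF A, of "1/2" B] by (simp add: C_def U_def)
  have "C * (U powr\<^sub>o \<nu> + r *\<^sub>R (1 + U - 2 *\<^sub>R U powr\<^sub>o (1/2))) * C \<le> C * ((1 - \<nu>) *\<^sub>R 1 + \<nu> *\<^sub>R U) * C"
    unfolding C_def by (intro sandwich_mono selfadjoint_powr_op A refined_young_op U \<nu> r)
  then show ?thesis
    by (simp add: distrib_left distrib_right left_diff_distrib right_diff_distrib CC CUC
        mult.commute[of r 2] arith_mean_def gm scaleR_add_right scaleR_diff_right)
qed

text \<open>
  The difference is half of \<open>A\<^bsup>1/2\<^esup> (1 - U\<^bsup>1/2\<^esup>)\<^sup>2 A\<^bsup>1/2\<^esup>\<close>.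
\<close>

lemma geom_mean_half_le_arith_mean:
  fixes A B :: "'a::chilbert bop"
  assumes A: "strictly_positive A" and B: "strictly_positive B"
  shows "geom_mean (1/2) A B \<le> arith_mean (1/2) A B"
proof -
  define C where "C = A powr\<^sub>o (1/2)"
  define U where "U = A powr\<^sub>o (-1/2) * B * A powr\<^sub>o (-1/2)"
  have gm: "geom_mean x A B = C * U powr\<^sub>o x * C" for x by (simp only: geom_mean_def C_def U_def)
  have U: "strictly_positive U" unfolding U_def by (intro strictly_positive_sandwich A B)
  define V where "V = U powr\<^sub>o (1/2)"
  have saV: "selfadjoint V" unfolding V_def by (rule selfadjoint_powr_op[OF U])
  have VV: "V * V = U" using powr_op_add[OF U, of "1/2" "1/2"] by (simp add: V_def powr_op_one[OF U])
  have CC: "C * C = A" using powr_op_add[OF A, of "1/2" "1/2"] by (simp add: C_def powr_op_one[OF A])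
  have CUC: "C * U * C = B" using sandwich_powr_op_cancel[OF A, of "1/2" B] by (simp add: C_def U_def)
  have "C * 0 * C \<le> C * ((1 - V) * (1 - V)) * C"
    unfolding C_def by (intro sandwich_mono selfadjoint_powr_op A square_nonneg selfadjoint_diff saV) simp
  then have "2 *\<^sub>R (C * V * C) \<le> A + B"
    by (simp add: distrib_left distrib_right left_diff_distrib right_diff_distrib CC CUC[unfolded mult.assoc] VV scaleR_2 algebra_simps)
  then have "(1/2) *\<^sub>R 2 *\<^sub>R (C * V * C) \<le> (1/2) *\<^sub>R (A + B)" by (intro scaleR_left_mono) auto
  then show ?thesis
    by (simp add: arith_mean_def gm V_def[symmetric] scaleR_add_right)
qed

text \<open>
  Ando's inequality.  Normalizing by \<open>A\<close> before and by \<open>\<Phi> A\<close> after \<open>\<Phi>\<close> gives another positive unital map \<open>\<Psi>\<close>, which takes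
  \<open>T = A\<^bsup>-1/2\<^esup> B A\<^bsup>-1/2\<^esup>\<close> to the corresponding operator \<open>S\<close> for \<open>\<Phi> A\<close> and \<open>\<Phi> B\<close>; so the claim is
  \<open>\<Psi>(T\<^bsup>\<nu>\<^esup>) \<le> \<Psi>(T)\<^bsup>\<nu>\<^esup>\<close>.
\<close>

lemma unital_positive_geom_mean_le:
  fixes \<Phi> :: "'a::chilbert bop \<Rightarrow> 'b::chilbert bop"
  assumes \<Phi>: "unital_positive \<Phi>" and A: "strictly_positive A" and B: "strictly_positive B"
    and \<nu>: "0 \<le> \<nu>" "\<nu> \<le> 1"
  shows "\<Phi> (geom_mean \<nu> A B) \<le> geom_mean \<nu> (\<Phi> A) (\<Phi> B)"
proof -
  define T where "T = A powr\<^sub>o (-1/2) * B * A powr\<^sub>o (-1/2)"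
  define S where "S = \<Phi> A powr\<^sub>o (-1/2) * \<Phi> B * \<Phi> A powr\<^sub>o (-1/2)"
  define \<Psi> where "\<Psi> X = \<Phi> A powr\<^sub>o (-1/2) * \<Phi> (A powr\<^sub>o (1/2) * X * A powr\<^sub>o (1/2)) * \<Phi> A powr\<^sub>o (-1/2)" for X
  note \<Phi>A = strictly_positive_unital_positive[OF \<Phi> A] and \<Phi>B = strictly_positive_unital_positive[OF \<Phi> B]
  have T: "strictly_positive T" unfolding T_def by (intro strictly_positive_sandwich A B)
  have S: "strictly_positive S" unfolding S_def by (intro strictly_positive_sandwich \<Phi>A \<Phi>B)
  have AA: "A powr\<^sub>o (1/2) * A powr\<^sub>o (1/2) = A" by (simp add: powr_op_one[OF A] flip: powr_op_add[OF A])
  have "unital_positive \<Psi>"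
    unfolding unital_positive_def
  proof (intro conjI linearI)
    show "\<Psi> (X + Y) = \<Psi> X + \<Psi> Y" "\<Psi> (c *\<^sub>R X) = c *\<^sub>R \<Psi> X" for X Y c
      by (simp_all add: \<Psi>_def distrib_left distrib_right unital_positive_simps[OF \<Phi>])
    show "positive_map \<Psi>"
      unfolding positive_map_def
    proof (intro allI impI)
      fix X :: "'a bop" assume "0 \<le> X"
      from unital_positive_mono[OF \<Phi> sandwich_mono[OF selfadjoint_powr_op[OF A, of "1/2"] this]]
      have "0 \<le> \<Phi> (A powr\<^sub>o (1/2) * X * A powr\<^sub>o (1/2))"
        using unital_positive_simps(4)[OF \<Phi>, of 0 1] by simp
      from sandwich_mono[OF selfadjoint_powr_op[OF \<Phi>A, of "-1/2"] this]
      show "0 \<le> \<Psi> X" by (simp add: \<Psi>_def)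
    qed
    have "\<Psi> 1 = \<Phi> A powr\<^sub>o (-1/2) * \<Phi> A powr\<^sub>o 1 * \<Phi> A powr\<^sub>o (-1/2)"
      by (simp add: \<Psi>_def AA powr_op_one[OF \<Phi>A])
    also have "\<dots> = 1" by (simp add: powr_op_zero[OF \<Phi>A] flip: powr_op_add[OF \<Phi>A])
    finally show "\<Psi> 1 = 1" .
  qed
  moreover have "\<Psi> T = S"
    using sandwich_powr_op_cancel[OF A, of "1/2" B] by (simp add: \<Psi>_def T_def S_def)
  ultimately have "\<Psi> (T powr\<^sub>o \<nu>) \<le> S powr\<^sub>o \<nu>"
    by (intro unital_positive_powr_le T S \<nu>) auto
  from sandwich_mono[OF selfadjoint_powr_op[OF \<Phi>A, of "1/2"] this]
  show ?thesis
    using sandwich_powr_op_cancel[OF \<Phi>A, of "1/2" "\<Phi> (geom_mean \<nu> A B)"]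
    unfolding \<Psi>_def geom_mean_def T_def[symmetric] S_def[symmetric] by simp
qed

lemma clinear_imp_linear:
  assumes "clinear f" shows "linear f"
proof -
  interpret Vector_Spaces.linear scaleC scaleC f by fact
  show ?thesis by (rule linearI) (simp_all add: add scale scaleR_scaleC)
qed

section \<open>The reverse arithmetic-geometric mean inequality\<close>

theorem theorem2p7:
  fixes m M \<nu> p r \<alpha> :: real
    and A B :: "'h::chilbert bop"
    and \<Phi> :: "'h bop \<Rightarrow> 'k::chilbert bop"
  assumes "0 < m" and "m \<le> M"
    and "m *\<^sub>R 1 \<le> A" and "A \<le> M *\<^sub>R 1"
    and "m *\<^sub>R 1 \<le> B" and "B \<le> M *\<^sub>R 1"
    and "clinear \<Phi>" and "positive_map \<Phi>" and "\<Phi> 1 = 1"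
    and "0 \<le> \<nu>" and "\<nu> \<le> 1"
    and "0 < p"
    and "r = min \<nu> (1 - \<nu>)"
    and "\<alpha> = max ((M + m)\<^sup>2 / (4 * M * m)) ((M + m)\<^sup>2 / (4 powr (2 / p) * M * m))"
  shows "(\<Phi> (arith_mean \<nu> A B + (2 * r * M * m) *\<^sub>R
              (arith_mean (1/2) (inv_op A) (inv_op B) - geom_mean (1/2) (inv_op A) (inv_op B)))
            powr\<^sub>o p
          \<le> \<alpha> powr p *\<^sub>R \<Phi> (geom_mean \<nu> A B) powr\<^sub>o p)
    \<and> (\<Phi> (arith_mean \<nu> A B + (2 * r * M * m) *\<^sub>R
              (arith_mean (1/2) (inv_op A) (inv_op B) - geom_mean (1/2) (inv_op A) (inv_op B)))
            powr\<^sub>o p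
          \<le> \<alpha> powr p *\<^sub>R (geom_mean \<nu> (\<Phi> A) (\<Phi> B)) powr\<^sub>o p)"
proof -
  note m = \<open>0 < m\<close> and \<nu> = \<open>0 \<le> \<nu>\<close> \<open>\<nu> \<le> 1\<close>
  have M: "0 < M" using assms(1,2) by simp
  have A: "strictly_positive A" and B: "strictly_positive B"
    using assms(1,3,5) by (auto intro: strictly_positiveI)
  have \<Phi>: "unital_positive \<Phi>"
    using assms(7-9) by (simp add: unital_positive_def clinear_imp_linear)
  define G where "G = geom_mean \<nu> A B"
  define N where "N = arith_mean (1/2) (inv_op A) (inv_op B) - geom_mean (1/2) (inv_op A) (inv_op B)"
  define X where "X = arith_mean \<nu> A B + (2 * r * M * m) *\<^sub>R N"
  have G: "strictly_positive G" unfolding G_def by (rule strictly_positive_geom_mean[OF A B])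
  have N: "0 \<le> N"
    unfolding N_def using geom_mean_half_le_arith_mean strictly_positive_inv_op[OF A] strictly_positive_inv_op[OF B]
    by simp
  have "m *\<^sub>R 1 = arith_mean \<nu> (m *\<^sub>R 1) (m *\<^sub>R (1 :: 'h bop))"
    by (simp add: arith_mean_def algebra_simps flip: scaleR_add_left)
  also have "\<dots> \<le> arith_mean \<nu> A B"
    unfolding arith_mean_def using \<nu> assms(3,5) by (intro add_mono scaleR_left_mono) auto
  also have "\<dots> \<le> X" unfolding X_def using N \<nu> m M assms(13) by (simp add: scaleR_nonneg_nonneg)
  finally have X: "strictly_positive X" using m by (intro strictly_positiveI)
  \<comment> \<open>The correction term in \<open>X\<close> is absorbed by the refined Young inequality for the inverses.\<close>
  have "X + (M * m) *\<^sub>R inv_op G = arith_mean \<nu> A B + (M * m) *\<^sub>R (inv_op G + (2 * r) *\<^sub>R N)"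
    by (simp add: X_def scaleR_add_right mult_ac)
  also have "\<dots> \<le> arith_mean \<nu> A B + (M * m) *\<^sub>R arith_mean \<nu> (inv_op A) (inv_op B)"
    unfolding G_def N_def inv_op_geom_mean[OF A B] using m M
    by (intro add_left_mono scaleR_left_mono refined_young_geom_mean strictly_positive_inv_op A B \<nu> assms(13)) auto
  also have "\<dots> = arith_mean \<nu> (A + (M * m) *\<^sub>R inv_op A) (B + (M * m) *\<^sub>R inv_op B)"
    by (simp add: arith_mean_def scaleR_add_right mult_ac)
  also have "\<dots> \<le> arith_mean \<nu> ((M + m) *\<^sub>R 1) ((M + m) *\<^sub>R 1)"
    unfolding arith_mean_def using \<nu>
    by (intro add_mono scaleR_left_mono add_scaled_inv_op_le m assms(3-6)) auto
  also have "\<dots> = (M + m) *\<^sub>R 1"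
    by (simp add: arith_mean_def algebra_simps flip: scaleR_add_left)
  finally have "X + (M * m) *\<^sub>R inv_op G \<le> (M + m) *\<^sub>R 1" .
  from unital_positive_mono[OF \<Phi> this]
  have XG: "\<Phi> X + (M * m) *\<^sub>R \<Phi> (inv_op G) \<le> (M + m) *\<^sub>R 1"
    by (simp add: unital_positive_simps[OF \<Phi>])
  \<comment> \<open>Both right-hand sides are powers of operators \<open>Q\<close> above \<open>\<Phi> G\<close>.\<close>
  have main: "\<Phi> X powr\<^sub>o p \<le> \<alpha> powr p *\<^sub>R Q powr\<^sub>o p" if "\<Phi> G \<le> Q" for Q
  proof (rule powr_op_le_of_add_inv_op_le[where h = "M * m" and L = "M + m"])
    show "strictly_positive Q"
      using strictly_positive_mono[OF strictly_positive_unital_positive[OF \<Phi> G] that] .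
    have "\<Phi> X + (M * m) *\<^sub>R inv_op Q \<le> \<Phi> X + (M * m) *\<^sub>R \<Phi> (inv_op G)"
      using m M by (intro add_left_mono scaleR_left_mono inv_op_le_of_unital_positive_le \<Phi> G that) auto
    then show "\<Phi> X + (M * m) *\<^sub>R inv_op Q \<le> (M + m) *\<^sub>R 1" using XG by (rule order_trans)
    show "(M + m)\<^sup>2 / (4 * (M * m)) \<le> \<alpha>" "(M + m)\<^sup>2 / (4 powr (2 / p) * (M * m)) \<le> \<alpha>"
      by (simp_all add: assms(14) mult.assoc)
  qed (use m M \<open>0 < p\<close> in \<open>auto intro: strictly_positive_unital_positive[OF \<Phi> X]\<close>)
  have "\<Phi> G \<le> geom_mean \<nu> (\<Phi> A) (\<Phi> B)"
    unfolding G_def by (rule unital_positive_geom_mean_le[OF \<Phi> A B \<nu>])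
  from main[OF this] main[OF order_refl] show ?thesis by (simp only: X_def N_def G_def)
qed

end
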